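(* Let $\mathcal{V}$ be a Euclidean Jordan algebra of rank $n$ with unit $e$, carrying the trace inner product, and let $T:\mathcal{V}\to\mathcal{V}$ be a positive linear map. Let $$\Lambda=\{\lambda(|T(c\circ\varepsilon)|): c\in\mathcal{I},\ \varepsilon\in\mathcal{E}\},\qquad \Lambda^*=\{\lambda(|T^*(c\circ\varepsilon)|): c\in\mathcal{I},\ \varepsilon\in\mathcal{E}\}.$$ Then $\operatorname{w-sup}(\Lambda)=\lambda(T(e))$ and $\operatorname{w-sup}(\Lambda^* )=\lambda(T^*(e))$. Hence $$\eta(T)=\lambda(T(e))\vee_w\lambda(T^*(e)).$$ In particular, if $T$ is also self-adjoint, then $\eta(T)=\lambda(T(e))$.
   Context: A Euclidean Jordan algebra $(\mathcal{V},\circ,\langle\cdot,\cdot\rangle)$ is a finite-dimensional real inner product space with a bilinear commutative product $\circ$ satisfying the Jordan identity $x\circ(x^2\circ y)=x^2\circ(x\circ y)$ (with $x^2=x\circ x$) and $\langle x\circ y,z\rangle=\langle x,y\circ z\rangle$ for all $x,y,z$, with unit element $e$. If $\mathcal{V}$ has rank $n$, every $x\in\mathcal{V}$ has a spectral decomposition $x=\sum_{i=1}^n x_ie_i$ with $\{e_1,\dots,e_n\}$ a Jordan frame (mutually orthogonal primitive idempotents summing to $e$) and $x_i\in\mathbb{R}$ the eigenvalues of $x$ (uniquely determined up to order). Here $\operatorname{tr}(x)=\sum_i x_i$, and the inner product is the trace inner product $\langle x,y\rangle=\operatorname{tr}(x\circ y)$. The eigenvalue vector $\lambda(x)\in\mathbb{R}^n$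 is the vector of eigenvalues of $x$ in decreasing order, and $|x|:=\sum_i|x_i|e_i$. The symmetric cone is $\mathcal{V}_+=\{x\in\mathcal{V}:\text{all eigenvalues of }x\text{ are}\ge 0\}$; $T$ is positive if $T(\mathcal{V}_+)\subseteq\mathcal{V}_+$. $T^*$ is the adjoint of $T$. $\mathcal{I}$ is the set of all nonzero idempotents ($c^2=c\neq0$) of $\mathcal{V}$, and $\mathcal{E}=\{\varepsilon\in\mathcal{V}:\varepsilon^2=e\}$. $\mathcal{R}^n_+$ is the set of nonnegative vectors in $\mathbb{R}^n$; $(\mathcal{R}^n_+)^{\downarrow}$ is the set of $q\in\mathcal{R}^n_+$ with $q_1\ge\cdots\ge q_n$. $p*q$ is the componentwise product, $p^\downarrow$ the decreasing rearrangement of $p$. For $p,q\in\mathbb{R}^n$, $p\prec_w q$ (weak majorization) means $\sum_{i=1}^k p_i^\downarrow\le\sum_{i=1}^k q_i^\downarrow$ for all $1\le k\le n$. For a nonempty bounded set $S\subseteq\mathcal{R}^n_+$, $\operatorname{w-sup}(S)$ is the unique $p^*\in(\mathcal{R}^n_+)^{\downarrow}$ (it exists, by a result of Bapat) such that $s\prec_w p^*$ for all $s\in S$, and $p^*\prec_w p$ whenever $p\in\mathcal{R}^n_+$ satisfies $s\prec_w p$ for all $s\in S$. The join is $r\vee_w s:=\operatorname{w-sup}(\{r,s\})$. The sets $\Lambda$ and $\Lambda^*$ are compact, so their w-sups are defined. For a linear map $T$ on $\mathcal{V}$, $\eta(T)$ denotes the unique (existing) vector in $(\mathcal{R}^n_+)^{\downarrow}$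 such that $\lambda(|T(x)|)\prec_w\eta(T)*\lambda(|x|)$ for all $x\in\mathcal{V}$, and $\eta(T)\prec_w q$ whenever $q\in(\mathcal{R}^n_+)^{\downarrow}$ satisfies $\lambda(|T(x)|)\prec_w q*\lambda(|x|)$ for all $x\in\mathcal{V}$. *)

theory Defs
  imports "HOL-Analysis.Analysis" "HOL-Computational_Algebra.Polynomial"
begin

section \<open>Vectors of \<open>\<real>\<^sup>n\<close>, as lists of length \<open>n\<close>\<close>

definition Rnonneg :: "nat \<Rightarrow> real list set" where
  "Rnonneg n = {p. length p = n \<and> (\<forall>a\<in>set p. 0 \<le> a)}"

definition Rnonneg_dec :: "nat \<Rightarrow> real list set" where
  "Rnonneg_dec n = {p \<in> Rnonneg n. sorted_wrt (\<ge>) p}"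

definition dec_rearr :: "real list \<Rightarrow> real list" where
  "dec_rearr p = rev (sort p)"

definition cprod :: "real list \<Rightarrow> real list \<Rightarrow> real list" (infixl "\<star>" 70) where
  "p \<star> q = map2 (*) p q"

definition weak_maj :: "real list \<Rightarrow> real list \<Rightarrow> bool" (infix "\<prec>\<^sub>w" 50) where
  "p \<prec>\<^sub>w q \<longleftrightarrow> length p = length q \<and>
     (\<forall>k\<in>{1..length p}. sum_list (take k (dec_rearr p)) \<le> sum_list (take k (dec_rearr q)))"

definition is_wsup :: "nat \<Rightarrow> real list set \<Rightarrow> real list \<Rightarrow> bool" where
  "is_wsup n S p \<longleftrightarrow> p \<in> Rnonneg_dec n \<and> (\<forall>s\<in>S. s \<prec>\<^sub>w p) \<and>
     (\<forall>q\<in>Rnonneg n. (\<forall>s\<in>S. s \<prec>\<^sub>w q) \<longrightarrow> p \<prec>\<^sub>w q)"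

text \<open>Meaningful for nonempty bounded \<open>S \<subseteq> Rnonneg n\<close>, where existence is a theorem of Bapat.\<close>

definition wsup :: "nat \<Rightarrow> real list set \<Rightarrow> real list" where
  "wsup n S = (THE p. is_wsup n S p)"

definition wjoin :: "nat \<Rightarrow> real list \<Rightarrow> real list \<Rightarrow> real list" where
  "wjoin n r s = wsup n {r, s}"


section \<open>Euclidean Jordan algebras\<close>

text \<open>The underlying inner product space is the type \<open>'a\<close>, with the inner product of its type
  class. This class only contains spaces of positive dimension, so the zero algebra is excluded.\<close>

locale euclidean_jordan_algebra =
  fixes jp :: "'a::euclidean_space \<Rightarrow> 'a \<Rightarrow> 'a" and e :: 'a
  assumes jp_bilinear: "bilinear jp"
    and jp_commute: "jp x y = jp y x"
    and jordan_identity: "jp x (jp (jp x x) y) = jp (jp x x) (jp x y)"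
    and jp_inner: "jp x y \<bullet> z = x \<bullet> jp y z"
    and jp_unit: "jp e x = x"

primrec jpow :: "('a::real_vector \<Rightarrow> 'a \<Rightarrow> 'a) \<Rightarrow> 'a \<Rightarrow> 'a \<Rightarrow> nat \<Rightarrow> 'a" where
  "jpow jp e x 0 = e"
| "jpow jp e x (Suc k) = jp x (jpow jp e x k)"

text \<open>The degree of \<open>x\<close> is the degree of its minimal polynomial; the rank of the algebra is the
  largest degree of an element. The degrees are bounded by the dimension of the space.\<close>

definition jdegree :: "('a::real_vector \<Rightarrow> 'a \<Rightarrow> 'a) \<Rightarrow> 'a \<Rightarrow> 'a \<Rightarrow> nat" where
  "jdegree jp e x = (LEAST d. \<exists>p :: real poly. p \<noteq> 0 \<and> degree p = d \<and>
     (\<Sum>i\<le>d. coeff p i *\<^sub>R jpow jp e x i) = 0)"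

definition jrank :: "('a::real_vector \<Rightarrow> 'a \<Rightarrow> 'a) \<Rightarrow> 'a \<Rightarrow> nat" where
  "jrank jp e = Max (range (jdegree jp e))"

definition idempotents :: "('a::real_vector \<Rightarrow> 'a \<Rightarrow> 'a) \<Rightarrow> 'a set" where
  "idempotents jp = {c. jp c c = c \<and> c \<noteq> 0}"

definition unit_roots :: "('a::real_vector \<Rightarrow> 'a \<Rightarrow> 'a) \<Rightarrow> 'a \<Rightarrow> 'a set" where
  "unit_roots jp e = {\<epsilon>. jp \<epsilon> \<epsilon> = e}"

definition primitive_idempotent :: "('a::real_vector \<Rightarrow> 'a \<Rightarrow> 'a) \<Rightarrow> 'a \<Rightarrow> bool" where
  "primitive_idempotent jp c \<longleftrightarrow> c \<in> idempotents jp \<and>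
     \<not> (\<exists>a\<in>idempotents jp. \<exists>b\<in>idempotents jp. c = a + b)"

text \<open>Jordan frames are enumerated by lists. Their length is not prescribed: that it always equals
  the rank is a theorem.\<close>

definition jordan_frame :: "('a::real_vector \<Rightarrow> 'a \<Rightarrow> 'a) \<Rightarrow> 'a \<Rightarrow> 'a list \<Rightarrow> bool" where
  "jordan_frame jp e cs \<longleftrightarrow> (\<forall>c\<in>set cs. primitive_idempotent jp c) \<and>
     (\<forall>i<length cs. \<forall>j<length cs. i \<noteq> j \<longrightarrow> jp (cs ! i) (cs ! j) = 0) \<and>
     sum_list cs = e"

definition spectral_decomp ::
  "('a::real_vector \<Rightarrow> 'a \<Rightarrow> 'a) \<Rightarrow> 'a \<Rightarrow> 'a \<Rightarrow> real list \<Rightarrow> 'a list \<Rightarrow> bool" where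
  "spectral_decomp jp e x as cs \<longleftrightarrow> jordan_frame jp e cs \<and> length as = length cs \<and>
     x = (\<Sum>i<length cs. (as ! i) *\<^sub>R (cs ! i))"

text \<open>By the spectral theorem, the decreasing list of eigenvalues and the element \<open>|x|\<close> exist and
  do not depend on the chosen decomposition.\<close>

definition eigvals :: "('a::real_vector \<Rightarrow> 'a \<Rightarrow> 'a) \<Rightarrow> 'a \<Rightarrow> 'a \<Rightarrow> real list" where
  "eigvals jp e x = (THE as. sorted_wrt (\<ge>) as \<and> (\<exists>cs. spectral_decomp jp e x as cs))"

definition jabs :: "('a::real_vector \<Rightarrow> 'a \<Rightarrow> 'a) \<Rightarrow> 'a \<Rightarrow> 'a \<Rightarrow> 'a" where
  "jabs jp e x = (THE y. \<exists>as cs. spectral_decomp jp e x as cs \<and>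
     y = (\<Sum>i<length cs. \<bar>as ! i\<bar> *\<^sub>R (cs ! i)))"

definition jtrace :: "('a::real_vector \<Rightarrow> 'a \<Rightarrow> 'a) \<Rightarrow> 'a \<Rightarrow> 'a \<Rightarrow> real" where
  "jtrace jp e x = sum_list (eigvals jp e x)"

definition symmetric_cone :: "('a::real_vector \<Rightarrow> 'a \<Rightarrow> 'a) \<Rightarrow> 'a \<Rightarrow> 'a set" where
  "symmetric_cone jp e = {x. \<forall>a\<in>set (eigvals jp e x). 0 \<le> a}"

definition positive_map ::
  "('a::real_vector \<Rightarrow> 'a \<Rightarrow> 'a) \<Rightarrow> 'a \<Rightarrow> ('a \<Rightarrow> 'a) \<Rightarrow> bool" where
  "positive_map jp e T \<longleftrightarrow> T ` symmetric_cone jp e \<subseteq> symmetric_cone jp e"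

definition is_eta ::
  "('a::real_vector \<Rightarrow> 'a \<Rightarrow> 'a) \<Rightarrow> 'a \<Rightarrow> ('a \<Rightarrow> 'a) \<Rightarrow> real list \<Rightarrow> bool" where
  "is_eta jp e T h \<longleftrightarrow> h \<in> Rnonneg_dec (jrank jp e) \<and>
     (\<forall>x. eigvals jp e (jabs jp e (T x)) \<prec>\<^sub>w h \<star> eigvals jp e (jabs jp e x)) \<and>
     (\<forall>q\<in>Rnonneg_dec (jrank jp e).
        (\<forall>x. eigvals jp e (jabs jp e (T x)) \<prec>\<^sub>w q \<star> eigvals jp e (jabs jp e x)) \<longrightarrow> h \<prec>\<^sub>w q)"

definition eta :: "('a::real_vector \<Rightarrow> 'a \<Rightarrow> 'a) \<Rightarrow> 'a \<Rightarrow> ('a \<Rightarrow> 'a) \<Rightarrow> real list" where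
  "eta jp e T = (THE h. is_eta jp e T h)"

end

theory Submission
  imports Defs
begin

text \<open>
  The statement is about eigenvalues, so everything rests on a spectral theorem for the algebra.
  Its existence half needs power associativity: linearizing the Jordan identity expresses the
  multiplication operator of \<open>x\<^sup>k\<^sup>+\<^sup>2\<close> through those of lower powers, so all of them commute with the
  multiplication by \<open>x\<close>, and the powers of \<open>x\<close> span an associative subalgebra. Self-adjoint operators
  have eigenvectors, and a subspace closed under the product contains a unit (the orthogonal
  projection of \<open>e\<close>), so eigenspaces inside that subalgebra produce orthogonal idempotents until \<open>e\<close>
  is exhausted; a family of maximal cardinality consists of primitive ones
  (\<open>spectral_theorem_set\<close>). Positivity enters through idempotents: multiplication \<open>L\<close> by
  one satisfies \<open>2L\<^sup>3 - 3L\<^sup>2 + L = 0\<close> and is therefore positive semidefinite.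

  The uniqueness half, and the fact that all Jordan frames have length equal to the rank, come from
  the trace form. Elements with distinct eigenvalues have only one decomposition up to order, so for
  them \<open>jtrace\<close> is the sum of the eigenvalues; comparing two such elements on the same frame shows
  \<open>c \<bullet> e = 1\<close> for every frame element \<open>c\<close> (\<open>frame_inner_unit\<close>). Multiplicities and frame lengths are
  then inner products with \<open>e\<close>.

  The cone is self-dual, and Ky Fan's principle holds: the sum of the \<open>k\<close> largest eigenvalues of \<open>z\<close>
  is the largest value of \<open>z \<bullet> p\<close> over sums \<open>p\<close> of \<open>k\<close> elements of a frame. It follows that
  \<open>-z \<le> y \<le> z\<close> in the cone order implies that the eigenvalues of \<open>|y|\<close> are weakly majorized by
  those of \<open>z\<close> (\<open>weak_maj_of_order\<close>). Since \<open>c \<circ> \<epsilon>\<close> lies between \<open>-e\<close> and \<open>e\<close>, positivity of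
  \<open>T\<close> bounds every member of \<open>\<Lambda>\<close> by the eigenvalues of \<open>T e\<close>, and this bound itself belongs to \<open>\<Lambda>\<close>.

  Let \<open>h\<close> be the join of the eigenvalue vectors of \<open>T e\<close> and \<open>T* e\<close>. To bound \<open>T x\<close>, replace \<open>x\<close> by
  \<open>|x| = \<Sum>a\<^sub>i c\<^sub>i\<close> with decreasing \<open>a\<close>. For a sum \<open>p\<close> of \<open>m\<close> frame elements and
  \<open>q\<^sub>k = c\<^sub>1 + \<dots> + c\<^sub>k\<close>, the number \<open>p \<bullet> T q\<^sub>k\<close> is at most \<open>p \<bullet> T e\<close> and at most \<open>T* e \<bullet> q\<^sub>k\<close>, so it
  is bounded by the sum of the first \<open>min k m\<close> entries of \<open>h\<close>; summation by parts gives exactly the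
  partial sum of \<open>h * a\<close> (\<open>positive_multiplicative_bound\<close>). Conversely any admissible multiplier
  dominates both vectors: test it on \<open>x = e\<close> and on the elements \<open>q\<^sub>k\<close> of a frame that
  diagonalizes \<open>T* e\<close>.
\<close>

section \<open>Power associativity and idempotent multiplication operators\<close>

context euclidean_jordan_algebra begin

lemma linear_jp: "linear (jp x)"
  using jp_bilinear by (simp add: bilinear_def)

lemma linear_jp_left: "linear (\<lambda>x. jp x y)"
  using jp_bilinear by (simp add: bilinear_def)

lemmas jp_simps =
  bilinear_ladd[OF jp_bilinear] bilinear_radd[OF jp_bilinear]
  bilinear_lsub[OF jp_bilinear] bilinear_rsub[OF jp_bilinear]
  bilinear_lmul[OF jp_bilinear] bilinear_rmul[OF jp_bilinear]
  bilinear_lzero[OF jp_bilinear] bilinear_rzero[OF jp_bilinear]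

lemma jp_sum_right: "jp x (\<Sum>i\<in>A. f i) = (\<Sum>i\<in>A. jp x (f i))"
  by (rule linear_sum[OF linear_jp])

lemma jp_sum_left: "jp (\<Sum>i\<in>A. f i) x = (\<Sum>i\<in>A. jp (f i) x)"
  using jp_sum_right jp_commute by simp

lemma jp_unit_right: "jp x e = x"
  using jp_unit jp_commute by metis

lemma inner_jp: "x \<bullet> jp y z = jp x y \<bullet> z"
  by (simp add: jp_inner)

lemma inner_unit: "jp x y \<bullet> e = x \<bullet> y"
  by (simp add: jp_inner jp_unit_right)

text \<open>
  The part of the Jordan identity for \<open>x + t z\<close> that is linear in \<open>t\<close>. The identity is cubic in
  its first argument, so its values at \<open>x + z\<close>, \<open>x - z\<close> and \<open>z\<close> isolate that part.
\<close>
lemma jordan_linearized: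
  "2 *\<^sub>R jp x (jp (jp x z) y) + jp z (jp (jp x x) y) =
   2 *\<^sub>R jp (jp x z) (jp x y) + jp (jp x x) (jp z y)"
proof -
  define D where "D u = jp u (jp (jp u u) y) - jp (jp u u) (jp u y)" for u
  have D0: "D u = 0" for u by (simp add: D_def jordan_identity)
  have "D (x + z) - D (x - z) - 2 *\<^sub>R D z =
    2 *\<^sub>R ((2 *\<^sub>R jp x (jp (jp x z) y) + jp z (jp (jp x x) y)) -
      (2 *\<^sub>R jp (jp x z) (jp x y) + jp (jp x x) (jp z y)))"
    by (simp add: D_def jp_simps jp_commute[of z x] algebra_simps scaleR_2)
  then show ?thesis by (simp add: D0)
qed

lemma jp_power2: "jp (jp x x) (jpow jp e x k) = jpow jp e x (Suc (Suc k))"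
proof (induction k)
  case (Suc k)
  have "jp (jp x x) (jpow jp e x (Suc k)) = jp x (jp (jp x x) (jpow jp e x k))"
    by (simp add: jordan_identity)
  then show ?case using Suc by simp
qed (simp add: jp_unit_right)

text \<open>
  Reading the linearized identity with \<open>y = x\<^sup>k\<close> as an equation between operators applied to \<open>z\<close>
  yields a recurrence for the multiplication by \<open>x\<^sup>k\<^sup>+\<^sup>2\<close>. Every operator on the right commutes with
  the multiplication by \<open>x\<close> as soon as those of \<open>x\<^sup>k\<close> and \<open>x\<^sup>k\<^sup>+\<^sup>1\<close> do.
\<close>
lemma jp_jpow_rec:
  "jp (jpow jp e x (Suc (Suc k))) z =
   2 *\<^sub>R jp (jpow jp e x (Suc k)) (jp x z) + jp (jp x x) (jp (jpow jp e x k) z)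
   - 2 *\<^sub>R jp x (jp (jpow jp e x k) (jp x z))"
  using jordan_linearized[of x z "jpow jp e x k"] jp_power2[of x k]
  by (simp add: jp_commute algebra_simps)

lemma jpow_operator_commute:
  "jp x (jp (jpow jp e x k) z) = jp (jpow jp e x k) (jp x z)"
proof (induction k arbitrary: z rule: less_induct)
  case (less k)
  consider "k = 0" | "k = 1" | j where "k = Suc (Suc j)"
    by (metis One_nat_def not0_implies_Suc)
  then show ?case
  proof cases
    case 3
    have 1: "jp x (jp (jpow jp e x (Suc j)) w) = jp (jpow jp e x (Suc j)) (jp x w)" for w
      using less[of "Suc j" w] 3 by simp
    have 2: "jp x (jp (jpow jp e x j) w) = jp (jpow jp e x j) (jp x w)" for w
      using less[of j w] 3 by simp
    show ?thesis
      unfolding 3 jp_jpow_rec by (simp only: jp_simps 1 2 jordan_identity)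
  qed (simp_all add: jp_unit jp_unit_right)
qed

text \<open>
  Power associativity: \<open>x\<^sup>m\<^sup>+\<^sup>k\<close> arises from \<open>x\<^sup>m\<close> by applying the multiplication by \<open>x\<close> exactly \<open>k\<close>
  times, and that operator may be moved past the multiplication by \<open>x\<^sup>m\<close>.
\<close>
lemma jpow_add: "jp (jpow jp e x m) (jpow jp e x k) = jpow jp e x (m + k)"
proof (induction k)
  case (Suc k)
  then show ?case by (simp flip: jpow_operator_commute)
qed (simp add: jp_unit_right)

lemma jp_idempotent_cubic:
  assumes "jp c c = c"
  shows "jp c x = 3 *\<^sub>R jp c (jp c x) - 2 *\<^sub>R jp c (jp c (jp c x))"
  using jordan_linearized[of c x c] assms
  by (simp add: jp_commute scaleR_left_distrib[of 1 2, simplified] algebra_simps)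

text \<open>
  The multiplication \<open>L\<close> by an idempotent is a root of \<open>2t\<^sup>3 - 3t\<^sup>2 + t = t(2t - 1)(t - 1)\<close>, so
  \<open>t\<close> may be replaced by any polynomial with the same values at \<open>0\<close>, \<open>1/2\<close> and \<open>1\<close>. The choice
  \<open>t\<^sup>2 + 4(t - t\<^sup>2)\<^sup>2\<close> is a sum of squares, which shows that \<open>L\<close> is positive semidefinite.
\<close>
lemma jp_idempotent_square:
  assumes "jp c c = c"
  shows "jp c x \<bullet> x = (norm (jp c x))\<^sup>2 + 4 * (norm (jp c x - jp c (jp c x)))\<^sup>2"
proof -
  let ?a = "jp c x" let ?b = "jp c ?a" let ?d = "jp c ?b"
  have 1: "?a = 3 *\<^sub>R ?b - 2 *\<^sub>R ?d"
    by (rule jp_idempotent_cubic[OF assms])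
  have s: "jp c u \<bullet> v = u \<bullet> jp c v" for u v
    by (metis jp_commute jp_inner)
  have "?a \<bullet> x = 3 * (?b \<bullet> x) - 2 * (?d \<bullet> x)"
    by (subst 1) (simp add: inner_diff_left)
  moreover have "?b \<bullet> x = ?a \<bullet> ?a" "?d \<bullet> x = ?b \<bullet> ?a"
    by (simp_all add: s)
  moreover have "?a \<bullet> ?a = 3 * (?b \<bullet> ?a) - 2 * (?b \<bullet> ?b)"
  proof -
    have "?a \<bullet> ?a = (3 *\<^sub>R ?b - 2 *\<^sub>R ?d) \<bullet> ?a"
      using 1 by simp
    moreover have "?d \<bullet> ?a = ?b \<bullet> ?b" by (simp add: s)
    ultimately show ?thesis by (simp add: inner_diff_left)
  qed
  ultimately show ?thesis
    by (simp add: power2_norm_eq_inner inner_diff_left inner_diff_right inner_commute)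
qed

lemma jp_idempotent_nonneg: "jp c c = c \<Longrightarrow> 0 \<le> jp c x \<bullet> x"
  by (simp add: jp_idempotent_square)

lemma inner_idempotents_nonneg:
  assumes "jp c c = c" "jp d d = d" shows "0 \<le> c \<bullet> d"
  using jp_idempotent_nonneg[OF assms(1), of d] assms(2) by (simp add: jp_inner)

text \<open>
  The sum of squares above vanishes only if \<open>jp c d\<close> does, so orthogonality for the inner product
  already forces the product to be zero.
\<close>
lemma idempotents_orthogonal_iff:
  assumes "jp c c = c" "jp d d = d" shows "c \<bullet> d = 0 \<longleftrightarrow> jp c d = 0"
proof
  assume "c \<bullet> d = 0"
  then have "jp c d \<bullet> d = 0" using assms(2) by (simp add: jp_inner)
  then have "(norm (jp c d))\<^sup>2 + 4 * (norm (jp c d - jp c (jp c d)))\<^sup>2 = 0"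
    using jp_idempotent_square[OF assms(1)] by simp
  then show "jp c d = 0"
    by (metis add_nonneg_eq_0_iff mult_nonneg_nonneg norm_eq_zero power_eq_0_iff zero_le_numeral zero_le_power2)
next
  assume "jp c d = 0"
  then show "c \<bullet> d = 0" using inner_unit[of c d] by simp
qed

end

section \<open>Existence of spectral decompositions\<close>

text \<open>
  A maximizer \<open>u\<close> of the quadratic form on the unit sphere of \<open>S\<close>, with maximum \<open>\<mu>\<close>, is an
  eigenvector: \<open>g = \<mu> - f\<close> is positive semidefinite and its form vanishes at \<open>u\<close>, and moving from \<open>u\<close>
  in the direction \<open>g u\<close> would make the form negative unless \<open>g u = 0\<close>.
\<close>
lemma selfadjoint_eigenvector:
  fixes f :: "'a::euclidean_space \<Rightarrow> 'a"
  assumes S: "subspace S" and f: "linear f" and inv: "\<And>u. u \<in> S \<Longrightarrow> f u \<in> S"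
    and sa: "\<And>u v. u \<in> S \<Longrightarrow> v \<in> S \<Longrightarrow> f u \<bullet> v = u \<bullet> f v"
    and ne: "s \<in> S" "s \<noteq> 0"
  obtains u \<mu> where "u \<in> S" "u \<noteq> 0" "f u = \<mu> *\<^sub>R u"
proof -
  let ?K = "sphere 0 1 \<inter> S"
  have "compact ?K"
    by (intro compact_Int_closed closed_subspace S) simp
  moreover have "s /\<^sub>R norm s \<in> ?K"
    using ne S by (simp add: subspace_mul)
  moreover have "continuous_on ?K (\<lambda>u. f u \<bullet> u)"
    by (intro continuous_intros linear_continuous_on linear_conv_bounded_linear[THEN iffD1] f)
  ultimately obtain u where u: "u \<in> ?K" and max: "\<And>v. v \<in> ?K \<Longrightarrow> f v \<bullet> v \<le> f u \<bullet> u"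
    using continuous_attains_sup[of ?K "\<lambda>u. f u \<bullet> u"] by blast
  define \<mu> where "\<mu> = f u \<bullet> u"
  define g where "g v = \<mu> *\<^sub>R v - f v" for v
  have uS: "u \<in> S" and u1: "u \<bullet> u = 1"
    using u by (auto simp: norm_eq_1)
  have gS: "g v \<in> S" if "v \<in> S" for v
    using that S inv by (simp add: g_def subspace_diff subspace_mul)
  have g_nonneg: "0 \<le> g v \<bullet> v" if v: "v \<in> S" for v
  proof (cases "v = 0")
    case False
    let ?w = "v /\<^sub>R norm v"
    have "?w \<in> ?K" using False v S by (simp add: subspace_mul)
    then have "f ?w \<bullet> ?w \<le> \<mu>" using max \<mu>_def by blast
    then have "f v \<bullet> v / (norm v)\<^sup>2 \<le> \<mu>"
      using f by (simp add: linear_cmul power2_eq_square field_simps)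
    then have "f v \<bullet> v \<le> \<mu> * (norm v)\<^sup>2"
      using False by (simp add: divide_le_eq)
    then show ?thesis by (simp add: g_def inner_diff_left power2_norm_eq_inner)
  qed (simp add: g_def)
  have gu: "g u \<bullet> u = 0" by (simp add: g_def inner_diff_left \<mu>_def u1)
  have lg: "g (v + t *\<^sub>R w) = g v + t *\<^sub>R g w" for v w t
    using f by (simp add: g_def linear_add linear_cmul algebra_simps)
  let ?w = "g u"
  have sg: "g ?w \<bullet> u = ?w \<bullet> ?w"
    using sa[OF gS[OF uS] uS]
    by (simp add: g_def[of "g u"] inner_diff_left) (simp add: g_def inner_diff_right inner_commute algebra_simps)
  have quad: "0 \<le> 2 * t * (?w \<bullet> ?w) + t * t * (g ?w \<bullet> ?w)" for t
  proof -
    have "0 \<le> g (u + t *\<^sub>R ?w) \<bullet> (u + t *\<^sub>R ?w)"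
      using g_nonneg uS gS S by (simp add: subspace_add subspace_mul)
    then show ?thesis
      by (simp add: lg inner_add_left inner_add_right gu sg algebra_simps)
  qed
  have "?w \<bullet> ?w = 0"
  proof (rule ccontr)
    assume "?w \<bullet> ?w \<noteq> 0"
    then have p: "0 < ?w \<bullet> ?w" by simp
    let ?q = "g ?w \<bullet> ?w"
    have q: "0 \<le> ?q" using g_nonneg gS uS by blast
    \<comment> \<open>Negative, and so small that the linear term of \<open>quad\<close> dominates; the \<open>+ 1\<close> covers \<open>?q = 0\<close>.\<close>
    define t where "t = - (?w \<bullet> ?w) / (?q + 1)"
    have tq: "t * (?q + 1) = - (?w \<bullet> ?w)" using q by (simp add: t_def)
    have t: "t < 0" using p q by (simp add: t_def divide_neg_pos)
    have "2 * t * (?w \<bullet> ?w) + t * t * ?q = t * (2 * (?w \<bullet> ?w) + t * (?q + 1) - t)"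
      by (simp add: algebra_simps)
    also have "\<dots> = t * (?w \<bullet> ?w - t)" unfolding tq by simp
    also have "\<dots> < 0" using t p by (intro mult_neg_pos) linarith+
    finally show False using quad[of t] by simp
  qed
  then have "f u = \<mu> *\<^sub>R u" by (simp add: g_def)
  then show ?thesis using that uS u1 by force
qed

context euclidean_jordan_algebra begin

text \<open>
  The unit is the orthogonal projection \<open>d\<close> of \<open>e\<close> onto \<open>A\<close>: for \<open>u\<close> and \<open>v\<close> in \<open>A\<close>, the inner product
  of \<open>jp d u\<close> with \<open>v\<close> is that of \<open>d\<close>, hence of \<open>e\<close>, with \<open>jp u v\<close>.
\<close>
lemma subalgebra_unit:
  assumes A: "subspace A" and closed: "\<And>u v. u \<in> A \<Longrightarrow> v \<in> A \<Longrightarrow> jp u v \<in> A"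
  obtains d where "d \<in> A" "\<And>u. u \<in> A \<Longrightarrow> jp d u = u"
proof -
  obtain d z where d: "d \<in> A" and z: "\<And>w. w \<in> A \<Longrightarrow> orthogonal z w" and ed: "e = d + z"
    using orthogonal_subspace_decomp_exists[of A e] A by (metis span_eq_iff)
  have "jp d u = u" if u: "u \<in> A" for u
  proof -
    have "jp d u \<bullet> v = u \<bullet> v" if v: "v \<in> A" for v
    proof -
      have "jp d u \<bullet> v = d \<bullet> jp u v" by (rule jp_inner)
      also have "\<dots> = e \<bullet> jp u v"
        using z[OF closed[OF u v]] by (simp add: ed orthogonal_def inner_add_left)
      also have "\<dots> = u \<bullet> v" by (simp add: inner_jp jp_unit)
      finally show ?thesis .
    qed
    then have "(jp d u - u) \<bullet> (jp d u - u) = 0"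
      using subspace_diff[OF A closed[OF d u] u] by (simp add: inner_diff_left)
    then show ?thesis by simp
  qed
  then show ?thesis using that d by blast
qed

definition orth_idempotents :: "'a set \<Rightarrow> bool" where
  "orth_idempotents C \<longleftrightarrow> C \<subseteq> idempotents jp \<and> (\<forall>c\<in>C. \<forall>d\<in>C. c \<noteq> d \<longrightarrow> jp c d = 0)"

lemma orth_idempotents_bound:
  assumes "orth_idempotents C" shows "finite C \<and> card C \<le> DIM('a)"
proof -
  have "pairwise orthogonal C"
    unfolding pairwise_def orthogonal_def
    using assms inner_unit by (metis inner_zero_left orth_idempotents_def)
  moreover have "0 \<notin> C" using assms by (auto simp: orth_idempotents_def idempotents_def)
  ultimately show ?thesis by (meson independent_bound pairwise_orthogonal_independent)
qed

text \<open>
  Orthogonal idempotents are linearly independent, so the dimension bounds the size of such families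
  and extremal arguments are available.
\<close>
lemma ex_max_orth_idempotents:
  assumes "P C0" "\<And>C. P C \<Longrightarrow> orth_idempotents C"
  shows "\<exists>C. P C \<and> (\<forall>D. P D \<longrightarrow> card D \<le> card C)"
proof (rule ex_has_greatest_nat[of P C0 card "DIM('a) + 1"])
  show "\<forall>C. P C \<longrightarrow> card C < DIM('a) + 1"
    using assms(2) orth_idempotents_bound by (simp add: less_Suc_eq_le)
qed (rule assms(1))

lemma orth_idempotents_mult_sum:
  assumes "orth_idempotents C" "c \<in> C"
  shows "jp c (\<Sum>C) = c"
proof -
  have fin: "finite C" using orth_idempotents_bound assms(1) by blast
  have "jp c (\<Sum>C) = (\<Sum>d\<in>C. jp c d)" by (simp add: jp_sum_right)
  also have "\<dots> = jp c c"
    using assms fin by (subst sum.remove[of _ c]) (auto simp: orth_idempotents_def intro!: sum.neutral)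
  finally show ?thesis using assms by (auto simp: orth_idempotents_def idempotents_def)
qed

abbreviation powers :: "'a \<Rightarrow> 'a set" where
  "powers x \<equiv> span (range (jpow jp e x))"

lemma span_mult_closed:
  assumes "\<And>u v. u \<in> P \<Longrightarrow> v \<in> P \<Longrightarrow> jp u v \<in> P" "u \<in> span P" "v \<in> span P"
  shows "jp u v \<in> span P"
proof -
  have 1: "jp w v \<in> span P" if "w \<in> P" for w
    using \<open>v \<in> span P\<close>
  proof (induction rule: span_induct_alt)
    case base show ?case by (simp add: jp_simps span_zero)
  next
    case (step c a b)
    then show ?case using assms(1)[OF that step(1)]
      by (simp add: jp_simps span_add span_scale span_base)
  qed
  show ?thesis using \<open>u \<in> span P\<close>
  proof (induction rule: span_induct_alt)
    case base show ?case by (simp add: jp_simps span_zero)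
  next
    case (step c a b)
    then show ?case using 1[OF step(1)] by (simp add: jp_simps span_add span_scale)
  qed
qed

lemma powers_mult_closed: "u \<in> powers x \<Longrightarrow> v \<in> powers x \<Longrightarrow> jp u v \<in> powers x"
  by (rule span_mult_closed) (auto simp: jpow_add)

lemma powers_assoc:
  assumes "u \<in> powers x" "v \<in> powers x" "w \<in> powers x"
  shows "jp (jp u v) w = jp u (jp v w)"
proof -
  let ?P = "range (jpow jp e x)"
  note lin = linear_compose[OF linear_jp_left linear_jp_left, unfolded o_def]
    linear_compose[OF linear_jp linear_jp_left, unfolded o_def]
    linear_compose[OF linear_jp_left linear_jp, unfolded o_def]
    linear_compose[OF linear_jp linear_jp, unfolded o_def] linear_jp linear_jp_left
  have 1: "jp (jp a b) w = jp a (jp b w)" if "a \<in> ?P" "b \<in> ?P" for a b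
    by (rule linear_eq_on_span[OF _ _ _ assms(3)])
      (use that in \<open>auto simp: jpow_add add.assoc intro: lin\<close>)
  have 2: "jp (jp a v) w = jp a (jp v w)" if "a \<in> ?P" for a
    by (rule linear_eq_on_span[OF _ _ _ assms(2)]) (use that 1 in \<open>auto intro: lin\<close>)
  show ?thesis
    by (rule linear_eq_on_span[OF _ _ _ assms(1)]) (use 2 in \<open>auto intro: lin\<close>)
qed

text \<open>
  Take a largest family of orthogonal idempotents that are eigenvectors of the multiplication by \<open>x\<close>
  in the associative algebra of the powers of \<open>x\<close>. If it did not sum to \<open>e\<close>, the complementary
  idempotent \<open>f\<close> would cut out a nonzero invariant subspace. An eigenspace inside it is a subalgebra,
  whose unit could be added to the family.
\<close>
lemma spectral_resolution:
  obtains C a where "orth_idempotents C" "\<Sum>C = e" "x = (\<Sum>c\<in>C. a c *\<^sub>R c)"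
proof -
  let ?W = "powers x"
  let ?P = "\<lambda>C. orth_idempotents C \<and> C \<subseteq> ?W \<and> (\<forall>c\<in>C. \<exists>t. jp x c = t *\<^sub>R c)"
  have "\<exists>C. ?P C \<and> (\<forall>D. ?P D \<longrightarrow> card D \<le> card C)"
    by (rule ex_max_orth_idempotents[of ?P "{}"]) (simp_all add: orth_idempotents_def)
  then obtain C where PC: "?P C" and max: "\<And>D. ?P D \<Longrightarrow> card D \<le> card C"
    by blast
  then have C: "orth_idempotents C" "C \<subseteq> ?W" "\<And>c. c \<in> C \<Longrightarrow> \<exists>t. jp x c = t *\<^sub>R c"
    by blast+
  have fin: "finite C" using orth_idempotents_bound C(1) by blast
  have pW: "jpow jp e x k \<in> ?W" for k by (intro span_base rangeI)
  have xW: "x \<in> ?W" using pW[of 1] by (simp add: jp_unit_right)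
  have eW: "e \<in> ?W" using pW[of 0] by simp
  define f where "f = e - \<Sum>C"
  have fW: "f \<in> ?W" unfolding f_def using C(2) eW by (intro span_diff span_sum) auto
  have Cf: "jp c f = 0" if "c \<in> C" for c
    using orth_idempotents_mult_sum[OF C(1) that] by (simp add: f_def jp_simps jp_unit_right)
  have ff: "jp f f = f"
  proof -
    have "jp f f = jp f e - (\<Sum>c\<in>C. jp f c)"
      by (subst (2) f_def) (simp add: jp_simps jp_sum_right)
    also have "(\<Sum>c\<in>C. jp f c) = 0" using Cf jp_commute by (simp add: sum.neutral)
    finally show ?thesis by (simp add: jp_unit_right)
  qed
  have "f = 0"
  proof (rule ccontr)
    assume f0: "f \<noteq> 0"
    let ?S = "{u \<in> ?W. jp f u = u}"
    have S: "subspace ?S"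
      by (auto simp: subspace_def jp_simps span_zero span_add span_scale)
    obtain u \<mu> where u: "u \<in> ?S" "u \<noteq> 0" "jp x u = \<mu> *\<^sub>R u"
    proof (rule selfadjoint_eigenvector[OF S linear_jp[of x] _ _ _ f0])
      show "jp x u \<in> ?S" if "u \<in> ?S" for u
        using that xW fW powers_mult_closed powers_assoc[OF fW xW, of u]
          powers_assoc[OF xW fW, of u] jp_commute[of f x] by auto
      show "jp x u \<bullet> v = u \<bullet> jp x v" for u v by (metis jp_commute jp_inner)
    qed (use fW ff in auto)
    let ?A = "{v \<in> ?W. jp f v = v \<and> jp x v = \<mu> *\<^sub>R v}"
    have A: "subspace ?A"
      by (auto simp: subspace_def jp_simps span_zero span_add span_scale scaleR_add_right)
    have AA: "jp v w \<in> ?A" if "v \<in> ?A" "w \<in> ?A" for v w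
      using that powers_mult_closed powers_assoc[OF fW, of v w] powers_assoc[OF xW, of v w]
      by (auto simp: jp_simps)
    obtain d where d: "d \<in> ?A" and unit: "\<And>v. v \<in> ?A \<Longrightarrow> jp d v = v"
      using subalgebra_unit[OF A AA] by blast
    have "u \<in> ?A" using u by auto
    then have d0: "d \<noteq> 0" using unit[of u] u by (auto simp: jp_simps)
    have dd: "jp d d = d" using unit d by blast
    have Cd: "jp c d = 0" if "c \<in> C" for c
    proof -
      have "jp c d = jp (jp c f) d" using powers_assoc[of c x f d] d fW C(2) that by auto
      then show ?thesis by (simp add: Cf that jp_simps)
    qed
    have dC': "jp d c = 0" if "c \<in> C" for c using Cd[OF that] jp_commute by metis
    have dC: "d \<notin> C" using Cd[of d] dd d0 by auto
    have "?P (insert d C)"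
      using C d dd d0 Cd dC' by (auto simp: orth_idempotents_def idempotents_def)
    then show False using max[of "insert d C"] fin dC by simp
  qed
  then have sum: "\<Sum>C = e" by (simp add: f_def)
  obtain a where a: "\<And>c. c \<in> C \<Longrightarrow> jp x c = a c *\<^sub>R c" using C(3) by metis
  have "x = jp x (\<Sum>C)" by (simp add: sum jp_unit_right)
  also have "\<dots> = (\<Sum>c\<in>C. a c *\<^sub>R c)" by (simp add: jp_sum_right a cong: sum.cong)
  finally show ?thesis using that C(1) sum by blast
qed

lemma idempotent_summands:
  assumes "jp a a = a" "jp b b = b" "jp (a + b) (a + b) = a + b"
  shows "jp a b = 0"
proof -
  have "2 *\<^sub>R jp a b = 0"
    using assms by (simp add: jp_simps jp_commute[of b a] scaleR_2 algebra_simps)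
  then show ?thesis by simp
qed

text \<open>
  Splitting an idempotent keeps its summands orthogonal to everything the idempotent was orthogonal
  to, because inner products of idempotents are nonnegative.
\<close>
lemma idempotent_summand_orthogonal:
  assumes "jp a a = a" "jp b b = b" "jp d d = d" "jp (a + b) d = 0"
  shows "jp a d = 0"
proof -
  have "a \<bullet> d + b \<bullet> d = 0"
    using assms(4) inner_unit[of "a + b" d] by (simp add: inner_add_left)
  then have "a \<bullet> d = 0"
    using inner_idempotents_nonneg[OF assms(1,3)] inner_idempotents_nonneg[OF assms(2,3)] by linarith
  then show ?thesis using idempotents_orthogonal_iff[OF assms(1,3)] by simp
qed

text \<open>
  A decomposition with the largest number of idempotents has primitive ones: otherwise one of them
  splits, and the pieces inherit its coefficient.
\<close>
lemma spectral_theorem_set: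
  obtains C a where "orth_idempotents C" "\<And>c. c \<in> C \<Longrightarrow> primitive_idempotent jp c"
    "\<Sum>C = e" "x = (\<Sum>c\<in>C. a c *\<^sub>R c)"
proof -
  let ?P = "\<lambda>C. orth_idempotents C \<and> \<Sum>C = e \<and> (\<exists>a. x = (\<Sum>c\<in>C. a c *\<^sub>R c))"
  obtain C0 where "?P C0" using spectral_resolution[of x] by blast
  then have "\<exists>C. ?P C \<and> (\<forall>D. ?P D \<longrightarrow> card D \<le> card C)"
    by (rule ex_max_orth_idempotents) blast
  then obtain C where PC: "?P C" and max: "\<And>D. ?P D \<Longrightarrow> card D \<le> card C"
    by blast
  then obtain a where C: "orth_idempotents C" "\<Sum>C = e" and x: "x = (\<Sum>c\<in>C. a c *\<^sub>R c)"
    by blast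
  have fin: "finite C" using orth_idempotents_bound C(1) by blast
  have idem: "jp d d = d" "d \<noteq> 0" if "d \<in> C" for d
    using that C(1) by (auto simp: orth_idempotents_def idempotents_def)
  have "primitive_idempotent jp c" if c: "c \<in> C" for c
  proof (rule ccontr)
    assume "\<not> primitive_idempotent jp c"
    then obtain p q where pq: "jp p p = p" "p \<noteq> 0" "jp q q = q" "q \<noteq> 0" and cpq: "c = p + q"
      using c C(1) by (auto simp: primitive_idempotent_def orth_idempotents_def idempotents_def)
    have p_q: "jp p q = 0" using idempotent_summands pq idem[OF c] cpq by auto
    define B where "B = C - {c}"
    have B: "jp p d = 0" "jp q d = 0" if "d \<in> B" for d
    proof -
      have "jp (p + q) d = 0" using that C(1) c cpq by (auto simp: B_def orth_idempotents_def)
      then show "jp p d = 0" "jp q d = 0"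
        using idempotent_summand_orthogonal[of p q d] idempotent_summand_orthogonal[of q p d]
          pq idem[of d] that by (auto simp: B_def add.commute)
    qed
    have B': "jp d p = 0" "jp d q = 0" if "d \<in> B" for d
      using B[OF that] jp_commute by metis+
    have q_p: "jp q p = 0" using p_q jp_commute by metis
    have notin: "p \<notin> B" "q \<notin> B" "p \<noteq> q" using B pq p_q by auto
    have finB: "finite B" "C = insert c B" "c \<notin> B" using fin c by (auto simp: B_def)
    define b where "b = a(p := a c, q := a c)"
    let ?D = "insert p (insert q B)"
    have Bb: "(\<Sum>d\<in>B. b d *\<^sub>R d) = (\<Sum>d\<in>B. a d *\<^sub>R d)"
      using notin by (intro sum.cong) (auto simp: b_def)
    have "x = (\<Sum>d\<in>?D. b d *\<^sub>R d)"
      unfolding x finB(2) using notin finB(1,3)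
      by (simp add: Bb) (simp add: b_def cpq scaleR_add_right)
    moreover have "\<Sum>?D = e"
      using C(2) notin finB by (simp add: cpq add.assoc)
    moreover have "orth_idempotents ?D"
      using C(1) B B' pq p_q q_p finB(2) by (auto simp: orth_idempotents_def idempotents_def)
    ultimately have "card ?D \<le> card C" using max by blast
    then show False using notin finB by simp
  qed
  then show ?thesis using that C x by blast
qed

text \<open>
  The key \<open>g\<close> is the identity when the eigenvalues themselves are to be sorted, and the absolute
  value when the eigenvalues of \<open>jabs\<close> are.
\<close>
lemma spectral_theorem:
  fixes g :: "real \<Rightarrow> real"
  obtains as cs where "spectral_decomp jp e x as cs" "sorted_wrt (\<ge>) (map g as)"
proof -
  obtain C a where C: "orth_idempotents C" "\<And>c. c \<in> C \<Longrightarrow> primitive_idempotent jp c"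
    "\<Sum>C = e" and x: "x = (\<Sum>c\<in>C. a c *\<^sub>R c)"
    using spectral_theorem_set by blast
  have "finite C" using orth_idempotents_bound C(1) by blast
  then obtain ds where ds: "set ds = C" "distinct ds" using finite_distinct_list by blast
  define cs where "cs = sort_key (\<lambda>c. - g (a c)) ds"
  have cs: "set cs = C" "distinct cs" by (simp_all add: cs_def ds)
  have "sorted (map (\<lambda>c. - g (a c)) cs)" by (simp add: cs_def)
  then have "sorted_wrt (\<ge>) (map g (map a cs))"
    by (simp add: sorted_wrt_map)
  moreover have "spectral_decomp jp e x (map a cs) cs"
    unfolding spectral_decomp_def jordan_frame_def
  proof (intro conjI allI impI)
    show "jp (cs ! i) (cs ! j) = 0" if "i < length cs" "j < length cs" "i \<noteq> j" for i j
      using that C(1) cs by (metis nth_eq_iff_index_eq nth_mem orth_idempotents_def)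
    have "x = sum_list (map (\<lambda>c. a c *\<^sub>R c) cs)"
      using cs by (simp add: x sum_list_distinct_conv_sum_set)
    then show "x = (\<Sum>i<length cs. map a cs ! i *\<^sub>R cs ! i)"
      by (simp add: sum_list_sum_nth lessThan_atLeast0)
    show "sum_list cs = e"
      using C(3) cs sum_list_distinct_conv_sum_set[of cs "\<lambda>x. x"] by simp
  qed (use C(2) cs in auto)
  ultimately show ?thesis using that by blast
qed

end

section \<open>Functional calculus along a Jordan frame\<close>

text \<open>
  Newton interpolation: a multiple of the polynomial that vanishes on the old nodes corrects the value
  at a new one.
\<close>
lemma ex_interpolating_poly:
  fixes f :: "'b::field \<Rightarrow> 'b"
  assumes "finite S" shows "\<exists>p. \<forall>t\<in>S. poly p t = f t"
  using assms
proof (induction S rule: finite_induct)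
  case (insert s S)
  then obtain p where p: "\<And>t. t \<in> S \<Longrightarrow> poly p t = f t" by blast
  let ?r = "\<Prod>t\<in>S. [:- t, 1:]"
  let ?q = "p + smult ((f s - poly p s) / poly ?r s) ?r"
  have "poly ?r t = 0" if "t \<in> S" for t
    using that insert.hyps(1) by (auto simp: poly_prod intro!: prod_zero)
  moreover have "poly ?r s \<noteq> 0"
    using insert.hyps by (auto simp: poly_prod)
  ultimately have "\<forall>t\<in>insert s S. poly ?q t = f t" using p by auto
  then show ?case by blast
qed auto

lemma decreasing_lists_eqI:
  fixes xs ys :: "'b::linorder list"
  assumes "sorted_wrt (\<ge>) xs" "sorted_wrt (\<ge>) ys" "mset xs = mset ys"
  shows "xs = ys"
proof -
  have "sorted (rev xs)" "sorted (rev ys)" using assms(1,2) by (simp_all add: sorted_wrt_rev)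
  then have "rev xs = rev ys"
    using properties_for_sort[of "rev xs" "rev ys"] assms(3) sorted_sort_id by (metis mset_rev)
  then show ?thesis by simp
qed

lemma count_mset_nth: "real (count (mset xs) t) = (\<Sum>i<length xs. of_bool (xs ! i = t))"
  by (induction xs) (simp_all add: sum.lessThan_Suc_shift del: sum.lessThan_Suc)

context euclidean_jordan_algebra begin

text \<open>
  The elements with coordinates \<open>a\<close> along a frame form an associative algebra that is isomorphic to
  \<open>\<real>\<^sup>n\<close> with componentwise operations. A subset of the frame is represented by its indicator.
\<close>
abbreviation comb :: "'a list \<Rightarrow> (nat \<Rightarrow> real) \<Rightarrow> 'a" where
  "comb cs a \<equiv> (\<Sum>i<length cs. a i *\<^sub>R cs ! i)"

lemma frame_idempotent:
  assumes "jordan_frame jp e cs" "i < length cs"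
  shows "jp (cs ! i) (cs ! i) = cs ! i" "cs ! i \<noteq> 0"
  using assms by (auto simp: jordan_frame_def primitive_idempotent_def idempotents_def)

lemma comb_one: "jordan_frame jp e cs \<Longrightarrow> comb cs (\<lambda>_. 1) = e"
  by (simp add: jordan_frame_def sum_list_sum_nth lessThan_atLeast0)

lemma frame_comb:
  assumes cs: "jordan_frame jp e cs" and i: "i < length cs"
  shows "jp (cs ! i) (comb cs a) = a i *\<^sub>R cs ! i"
proof -
  have "jp (cs ! i) (comb cs a) = (\<Sum>j<length cs. a j *\<^sub>R jp (cs ! i) (cs ! j))"
    by (simp add: jp_sum_right jp_simps)
  also have "\<dots> = a i *\<^sub>R jp (cs ! i) (cs ! i)"
    using cs i by (subst sum.remove[of _ i]) (auto simp: jordan_frame_def intro!: sum.neutral)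
  finally show ?thesis using frame_idempotent[OF cs i] by simp
qed

lemma comb_mult:
  assumes "jordan_frame jp e cs"
  shows "jp (comb cs a) (comb cs b) = comb cs (\<lambda>i. a i * b i)"
proof -
  have "jp (comb cs a) (comb cs b) = (\<Sum>i<length cs. a i *\<^sub>R jp (cs ! i) (comb cs b))"
    by (simp only: jp_sum_left jp_simps)
  also have "\<dots> = comb cs (\<lambda>i. a i * b i)"
    by (rule sum.cong) (simp_all add: frame_comb[OF assms])
  finally show ?thesis .
qed

lemma comb_inject:
  assumes cs: "jordan_frame jp e cs" and eq: "comb cs a = comb cs b" and i: "i < length cs"
  shows "a i = b i"
  using frame_comb[OF cs i, of a] frame_comb[OF cs i, of b] eq frame_idempotent[OF cs i] by simp

lemma comb_indicator_idempotent:
  assumes "jordan_frame jp e cs"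
  shows "jp (comb cs (\<lambda>i. of_bool (P i))) (comb cs (\<lambda>i. of_bool (P i))) = comb cs (\<lambda>i. of_bool (P i))"
  unfolding comb_mult[OF assms] by (rule sum.cong) simp_all

lemma jpow_comb:
  assumes "jordan_frame jp e cs"
  shows "jpow jp e (comb cs a) k = comb cs (\<lambda>i. a i ^ k)"
  by (induction k) (simp_all add: comb_one[OF assms, simplified] comb_mult[OF assms])

lemma poly_comb:
  assumes "jordan_frame jp e cs"
  shows "(\<Sum>k\<le>degree p. coeff p k *\<^sub>R jpow jp e (comb cs a) k) = comb cs (\<lambda>i. poly p (a i))"
proof -
  have "(\<Sum>k\<le>degree p. coeff p k *\<^sub>R jpow jp e (comb cs a) k)
    = (\<Sum>k\<le>degree p. \<Sum>i<length cs. (coeff p k * a i ^ k) *\<^sub>R cs ! i)"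
    by (simp add: jpow_comb[OF assms] scaleR_sum_right)
  also have "\<dots> = (\<Sum>i<length cs. \<Sum>k\<le>degree p. (coeff p k * a i ^ k) *\<^sub>R cs ! i)"
    by (rule sum.swap)
  finally show ?thesis by (simp add: poly_altdef scaleR_sum_left)
qed

lemma spectral_decompD:
  assumes "spectral_decomp jp e x as cs"
  shows "jordan_frame jp e cs" "length as = length cs" "x = comb cs ((!) as)"
  using assms by (simp_all add: spectral_decomp_def)

lemma spectral_decompI:
  assumes "jordan_frame jp e cs"
  shows "spectral_decomp jp e (comb cs a) (map a [0..<length cs]) cs"
  using assms by (simp add: spectral_decomp_def)

text \<open>
  Both sides are the value at \<open>x\<close> of a polynomial that interpolates \<open>f\<close> on all eigenvalues
  involved, and polynomials in \<open>x\<close> are defined without reference to a frame.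
\<close>
lemma functional_calculus:
  assumes "spectral_decomp jp e x as cs" "spectral_decomp jp e x bs ds"
  shows "comb cs (\<lambda>i. f (as ! i)) = comb ds (\<lambda>i. f (bs ! i))"
proof -
  note c = spectral_decompD[OF assms(1)] and d = spectral_decompD[OF assms(2)]
  obtain p where p: "\<And>t. t \<in> set as \<union> set bs \<Longrightarrow> poly p t = f t"
    using ex_interpolating_poly[of "set as \<union> set bs" f] by auto
  have "comb cs (\<lambda>i. f (as ! i)) = comb cs (\<lambda>i. poly p (as ! i))"
    using c(2) p by (intro sum.cong) auto
  also have "\<dots> = comb ds (\<lambda>i. poly p (bs ! i))"
    using poly_comb[OF c(1), of p "(!) as"] poly_comb[OF d(1), of p "(!) bs"] c(3) d(3) by simp
  also have "\<dots> = comb ds (\<lambda>i. f (bs ! i))"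
    using d(2) p by (intro sum.cong) auto
  finally show ?thesis .
qed

lemma jabs_eq:
  assumes "spectral_decomp jp e x as cs"
  shows "jabs jp e x = comb cs (\<lambda>i. \<bar>as ! i\<bar>)"
  unfolding jabs_def using assms functional_calculus[of x _ _ as cs abs]
  by (intro the_equality) blast+

lemma comb_indicator_eq_0_iff:
  assumes "jordan_frame jp e cs"
  shows "comb cs (\<lambda>i. of_bool (P i)) = 0 \<longleftrightarrow> (\<forall>i<length cs. \<not> P i)"
  using comb_inject[OF assms, of "\<lambda>i. of_bool (P i)" "\<lambda>_. 0"] by auto

text \<open>
  If two elements of the frame contributed, one of them and the sum of the others would split the
  primitive idempotent.
\<close>
lemma primitive_eq_comb_indicator:
  assumes cs: "jordan_frame jp e cs" and prim: "primitive_idempotent jp c"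
    and eq: "c = comb cs (\<lambda>i. of_bool (P i))"
  shows "(\<Sum>i<length cs. of_bool (P i)) = (1::real)"
proof -
  have "c \<noteq> 0" using prim by (simp add: primitive_idempotent_def idempotents_def)
  then obtain j where j: "j < length cs" "P j"
    using eq comb_indicator_eq_0_iff[OF cs] by blast
  let ?R = "comb cs (\<lambda>i. of_bool (P i \<and> i \<noteq> j))"
  have "c = comb cs (\<lambda>i. of_bool (i = j)) + ?R"
    unfolding eq sum.distrib[symmetric] by (rule sum.cong) (use j in auto)
  moreover have "comb cs (\<lambda>i. of_bool (i = j)) \<in> idempotents jp"
    using comb_indicator_idempotent[OF cs] comb_indicator_eq_0_iff[OF cs] j(1)
    by (auto simp: idempotents_def)
  moreover have "?R \<notin> idempotents jp"
    using prim calculation by (auto simp: primitive_idempotent_def)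
  ultimately have "?R = 0"
    using comb_indicator_idempotent[OF cs] by (auto simp: idempotents_def)
  then have "\<forall>i<length cs. \<not> (P i \<and> i \<noteq> j)" by (simp only: comb_indicator_eq_0_iff[OF cs])
  then have only: "P i \<longleftrightarrow> i = j" if "i < length cs" for i
    using that j(2) by blast
  have "(\<Sum>i<length cs. of_bool (P i)) = (\<Sum>i<length cs. if i = j then 1 else (0::real))"
    by (rule sum.cong) (simp_all add: only)
  also have "\<dots> = 1" using j(1) by simp
  finally show ?thesis .
qed

text \<open>
  With distinct eigenvalues, the functional calculus recovers each frame element from \<open>x\<close> alone, as
  the idempotent of one eigenvalue. It is primitive, so in any other decomposition that eigenvalue
  occurs exactly once.
\<close>
lemma eigvals_simple:
  assumes d: "spectral_decomp jp e x as cs" and dist: "sorted_wrt (>) as"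
  shows "eigvals jp e x = as"
  unfolding eigvals_def
proof (rule the_equality)
  show dec: "sorted_wrt (\<ge>) as \<and> (\<exists>cs. spectral_decomp jp e x as cs)"
    using d sorted_wrt_mono_rel[OF _ dist, of "(\<ge>)"] by auto
  fix bs assume bs: "sorted_wrt (\<ge>) bs \<and> (\<exists>cs. spectral_decomp jp e x bs cs)"
  then obtain ds where d': "spectral_decomp jp e x bs ds" by blast
  note c = spectral_decompD[OF d] and c' = spectral_decompD[OF d']
  have inj: "as ! i = as ! j \<longleftrightarrow> i = j" if "i < length as" "j < length as" for i j
    using that dist by (metis linorder_neqE_nat order_less_irrefl sorted_wrt_nth_less)
  have "real (count (mset bs) t) = real (count (mset as) t)" for t
  proof -
    have eq: "comb cs (\<lambda>i. of_bool (as ! i = t)) = comb ds (\<lambda>i. of_bool (bs ! i = t))"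
      by (rule functional_calculus[OF d d'])
    show ?thesis
    proof (cases "t \<in> set as")
      case False
      then have "comb ds (\<lambda>i. of_bool (bs ! i = t)) = 0"
        using c(2) by (subst eq[symmetric]) (auto intro!: sum.neutral)
      then have "t \<notin> set bs"
        using comb_indicator_eq_0_iff[OF c'(1)] c'(2) by (simp add: in_set_conv_nth)
      then show ?thesis using False by (simp add: count_eq_zero_iff[THEN iffD2])
    next
      case True
      then obtain i where i: "i < length as" "as ! i = t" by (metis in_set_conv_nth)
      have as_t: "as ! k = t \<longleftrightarrow> k = i" if "k < length as" for k
        using inj[OF that i(1)] i(2) by simp
      have "comb cs (\<lambda>k. of_bool (as ! k = t)) = (\<Sum>k<length cs. if k = i then cs ! k else 0)"
        using as_t c(2) by (intro sum.cong) auto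
      then have "cs ! i = comb ds (\<lambda>k. of_bool (bs ! k = t))" using eq i c(2) by simp
      moreover have "primitive_idempotent jp (cs ! i)"
        using c(1,2) i by (auto simp: jordan_frame_def)
      ultimately have "real (count (mset bs) t) = 1"
        using primitive_eq_comb_indicator[OF c'(1), of "cs ! i"] c'(2) by (simp add: count_mset_nth)
      moreover have "real (count (mset as) t) = (\<Sum>k<length as. if k = i then 1 else 0)"
        unfolding count_mset_nth using as_t by (intro sum.cong) auto
      ultimately show ?thesis using i by simp
    qed
  qed
  then have "mset bs = mset as" by (intro multiset_eqI) simp
  then show "bs = as" using decreasing_lists_eqI bs dec by metis
qed

end

section \<open>The trace form: uniqueness of eigenvalues and the rank\<close>

locale trace_form_jordan_algebra = euclidean_jordan_algebra +
  assumes trace_inner: "x \<bullet> y = jtrace jp e (jp x y)"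
begin

lemma jtrace_inner: "jtrace jp e x = x \<bullet> e"
  by (simp add: trace_inner jp_unit_right)

text \<open>
  For strictly decreasing coordinates \<open>a\<close> the trace is known to be \<open>\<Sum>a\<^sub>i\<close>, while the trace form
  expresses it as \<open>\<Sum>a\<^sub>i (c\<^sub>i \<bullet> e)\<close>. Raising the first \<open>j\<close> or the first \<open>j + 1\<close> coordinates by one
  preserves strict decrease, and the difference of the two equations isolates \<open>cs ! j \<bullet> e\<close>.
\<close>
lemma frame_inner_unit:
  assumes cs: "jordan_frame jp e cs" and j: "j < length cs"
  shows "cs ! j \<bullet> e = 1"
proof -
  let ?N = "length cs"
  have tr: "(\<Sum>i<?N. a i * (cs ! i \<bullet> e)) = (\<Sum>i<?N. a i)"
    if a: "\<And>i j. i < j \<Longrightarrow> a j < a i" for a :: "nat \<Rightarrow> real"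
  proof -
    have "sorted_wrt (>) (map a [0..<?N])"
      by (simp add: sorted_wrt_map sorted_wrt_iff_nth_less a)
    then have "eigvals jp e (comb cs a) = map a [0..<?N]"
      using eigvals_simple[OF spectral_decompI[OF cs]] by blast
    then have "comb cs a \<bullet> e = sum_list (map a [0..<?N])"
      by (simp add: jtrace_inner[symmetric] jtrace_def)
    then show ?thesis by (simp add: inner_sum_left interv_sum_list_conv_sum_set_nat lessThan_atLeast0)
  qed
  \<comment> \<open>The coordinates \<open>0, -1, -2, \<dots>\<close> with the first \<open>k\<close> raised by one.\<close>
  define b :: "nat \<Rightarrow> nat \<Rightarrow> real" where "b k i = of_bool (i < k) - real i" for k i
  define w where "w i = cs ! i \<bullet> e - 1" for i
  have "(\<Sum>i<?N. b k i * w i) = 0" for k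
  proof -
    have "b k j < b k i" if "i < j" for i j using that by (simp add: b_def)
    then show ?thesis using tr[of "b k"] by (simp add: w_def right_diff_distrib sum_subtractf)
  qed
  then have "(\<Sum>i<?N. b (Suc j) i * w i) - (\<Sum>i<?N. b j i * w i) = 0" by simp
  then have "(\<Sum>i<?N. (b (Suc j) i - b j i) * w i) = 0"
    by (simp add: sum_subtractf left_diff_distrib)
  also have "(\<Sum>i<?N. (b (Suc j) i - b j i) * w i) = (\<Sum>i<?N. if i = j then w i else 0)"
    by (rule sum.cong) (auto simp: b_def)
  finally show ?thesis using j by (simp add: w_def)
qed

lemma comb_inner_unit: "jordan_frame jp e cs \<Longrightarrow> comb cs a \<bullet> e = (\<Sum>i<length cs. a i)"
  unfolding inner_sum_left by (rule sum.cong) (simp_all add: frame_inner_unit)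

text \<open>
  The multiplicity of an eigenvalue \<open>t\<close> is the inner product of \<open>e\<close> with the idempotent belonging to
  \<open>t\<close>, which depends on \<open>x\<close> only.
\<close>
lemma eigvals_eq:
  assumes d: "spectral_decomp jp e x as cs" and dec: "sorted_wrt (\<ge>) as"
  shows "eigvals jp e x = as"
  unfolding eigvals_def
proof (rule the_equality)
  show "sorted_wrt (\<ge>) as \<and> (\<exists>cs. spectral_decomp jp e x as cs)" using assms by blast
  fix bs assume bs: "sorted_wrt (\<ge>) bs \<and> (\<exists>cs. spectral_decomp jp e x bs cs)"
  then obtain ds where d': "spectral_decomp jp e x bs ds" by blast
  note c = spectral_decompD[OF d] and c' = spectral_decompD[OF d']
  have "real (count (mset bs) t) = real (count (mset as) t)" for t
    using functional_calculus[OF d d', of "\<lambda>s. of_bool (s = t)"] c(2) c'(2)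
      comb_inner_unit[OF c(1), of "\<lambda>i. of_bool (as ! i = t)"]
      comb_inner_unit[OF c'(1), of "\<lambda>i. of_bool (bs ! i = t)"]
    by (simp add: count_mset_nth del: sum_of_bool_eq)
  then have "mset bs = mset as" by (intro multiset_eqI) simp
  then show "bs = as" using decreasing_lists_eqI bs dec by metis
qed

lemma frame_length_inner: "jordan_frame jp e cs \<Longrightarrow> real (length cs) = e \<bullet> e"
  using comb_inner_unit[of cs "\<lambda>_. 1"] comb_one[of cs] by simp

lemma jdegree_upper:
  assumes "jordan_frame jp e cs"
  shows "jdegree jp e (comb cs a) \<le> length cs"
proof -
  let ?p = "\<Prod>i<length cs. [:- a i, 1:]"
  have deg: "degree ?p = length cs" by (subst degree_prod_eq_sum_degree) simp_all
  moreover have "?p \<noteq> 0" by simp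
  moreover have "(\<Sum>k\<le>degree ?p. coeff ?p k *\<^sub>R jpow jp e (comb cs a) k) = 0"
    unfolding poly_comb[OF assms] by (intro sum.neutral) (auto simp: poly_prod intro!: prod_zero)
  ultimately show ?thesis
    unfolding jdegree_def by (intro Least_le exI[of _ ?p]) (simp add: deg del: prod_zero_iff)
qed

lemma jdegree_lower:
  assumes cs: "jordan_frame jp e cs" and inj: "inj_on a {..<length cs}"
  shows "length cs \<le> jdegree jp e (comb cs a)"
proof -
  have bound: "length cs \<le> degree p"
    if p: "p \<noteq> 0" "(\<Sum>k\<le>degree p. coeff p k *\<^sub>R jpow jp e (comb cs a) k) = 0" for p
  proof -
    have "comb cs (\<lambda>i. poly p (a i)) = comb cs (\<lambda>_. 0)" using p(2) poly_comb[OF cs] by simp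
    then have "poly p (a i) = 0" if "i < length cs" for i using comb_inject[OF cs, of "\<lambda>i. poly p (a i)" "\<lambda>_. 0"] that by blast
    then have "a ` {..<length cs} \<subseteq> {t. poly p t = 0}" by auto
    then have "card (a ` {..<length cs}) \<le> card {t. poly p t = 0}"
      using p(1) by (intro card_mono poly_roots_finite)
    also have "\<dots> \<le> degree p" using p(1) by (rule card_poly_roots_bound)
    finally show ?thesis using inj by (simp add: card_image)
  qed
  let ?Q = "\<lambda>d. \<exists>p :: real poly. p \<noteq> 0 \<and> degree p = d \<and>
     (\<Sum>i\<le>d. coeff p i *\<^sub>R jpow jp e (comb cs a) i) = 0"
  let ?p = "\<Prod>i<length cs. [:- a i, 1:]"
  have "?Q (degree ?p)"
  proof (intro exI[of _ ?p] conjI)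
    show "(\<Sum>k\<le>degree ?p. coeff ?p k *\<^sub>R jpow jp e (comb cs a) k) = 0"
      unfolding poly_comb[OF cs] by (intro sum.neutral) (auto simp: poly_prod intro!: prod_zero)
  qed simp_all
  then have "?Q (LEAST d. ?Q d)" by (rule LeastI)
  then obtain p :: "real poly" where p: "p \<noteq> 0" "degree p = jdegree jp e (comb cs a)"
    "(\<Sum>i\<le>degree p. coeff p i *\<^sub>R jpow jp e (comb cs a) i) = 0"
    unfolding jdegree_def[symmetric] by (elim exE conjE) simp
  show ?thesis using bound[OF p(1,3)] p(2) by simp
qed

text \<open>
  A polynomial annihilates \<open>x\<close> iff it vanishes at all eigenvalues of \<open>x\<close>, so the degree of \<open>x\<close> is the
  number of its distinct eigenvalues. On a given frame all of them can be made distinct.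
\<close>
lemma jrank_eq:
  assumes cs: "jordan_frame jp e cs" shows "jrank jp e = length cs"
proof -
  have le: "jdegree jp e x \<le> length cs" for x
  proof -
    obtain as ds where "spectral_decomp jp e x as ds" using spectral_theorem by blast
    note d = spectral_decompD[OF this]
    have "length ds = length cs"
      using frame_length_inner[OF cs] frame_length_inner[OF d(1)] by simp
    then show ?thesis using jdegree_upper[OF d(1)] d(3) by metis
  qed
  have "jdegree jp e (comb cs real) = length cs"
    by (intro antisym le jdegree_lower[OF cs]) (simp add: inj_on_def)
  moreover have "finite (range (jdegree jp e))"
    by (rule finite_subset[of _ "{..length cs}"]) (use le in blast, simp)
  ultimately show ?thesis
    unfolding jrank_def using le by (intro Max_eqI) (metis rangeE rangeI)+
qed

end

section \<open>Weak majorization, joins and summation by parts\<close>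

definition topsum :: "nat \<Rightarrow> real list \<Rightarrow> real" where
  "topsum k p = sum_list (take k (dec_rearr p))"

lemma length_dec_rearr [simp]: "length (dec_rearr p) = length p"
  by (simp add: dec_rearr_def)

lemma dec_rearr_dec: "sorted_wrt (\<ge>) (dec_rearr p)"
  by (simp add: dec_rearr_def sorted_wrt_rev)

lemma dec_rearr_id: "sorted_wrt (\<ge>) p \<Longrightarrow> dec_rearr p = p"
proof -
  assume "sorted_wrt (\<ge>) p"
  then have "sorted (rev p)" by (simp add: sorted_wrt_rev)
  then have "sort p = rev p" by (metis mset_rev properties_for_sort)
  then show ?thesis by (simp add: dec_rearr_def)
qed

lemma sum_list_take_nth: "k \<le> length p \<Longrightarrow> sum_list (take k p) = (\<Sum>i<k. p ! i)"
  by (simp add: sum_list_sum_nth lessThan_atLeast0)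

lemma topsum_nth: "k \<le> length p \<Longrightarrow> topsum k p = (\<Sum>i<k. dec_rearr p ! i)"
  by (simp add: topsum_def sum_list_take_nth)

lemma topsum_dec: "sorted_wrt (\<ge>) p \<Longrightarrow> k \<le> length p \<Longrightarrow> topsum k p = (\<Sum>i<k. p ! i)"
  by (simp add: topsum_nth dec_rearr_id)

lemma weak_maj_iff:
  "p \<prec>\<^sub>w q \<longleftrightarrow> length p = length q \<and> (\<forall>k\<le>length p. topsum k p \<le> topsum k q)"
proof -
  have "topsum 0 p \<le> topsum 0 q" by (simp add: topsum_def)
  then have "(\<forall>k\<in>{1..m}. topsum k p \<le> topsum k q) \<longleftrightarrow> (\<forall>k\<le>m. topsum k p \<le> topsum k q)" for m
    by (metis atLeastAtMost_iff less_one not_le)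
  then show ?thesis by (simp add: weak_maj_def topsum_def)
qed

lemma weak_maj_trans: "p \<prec>\<^sub>w q \<Longrightarrow> q \<prec>\<^sub>w r \<Longrightarrow> p \<prec>\<^sub>w r"
  unfolding weak_maj_iff by (metis order_trans)

lemma weak_maj_refl: "p \<prec>\<^sub>w p"
  by (simp add: weak_maj_iff)

lemma Rnonneg_decD:
  assumes "p \<in> Rnonneg_dec n"
  shows "length p = n" "sorted_wrt (\<ge>) p" "\<And>i. i < n \<Longrightarrow> 0 \<le> p ! i" "p \<in> Rnonneg n"
    "\<And>i j. i \<le> j \<Longrightarrow> j < n \<Longrightarrow> p ! j \<le> p ! i"
  using assms by (auto simp: Rnonneg_dec_def Rnonneg_def dest: sorted_wrt_nth_less
    intro: order_refl elim: le_neq_implies_less)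

lemma weak_maj_antisym:
  assumes p: "p \<in> Rnonneg_dec n" and q: "q \<in> Rnonneg_dec n" and pq: "p \<prec>\<^sub>w q" "q \<prec>\<^sub>w p"
  shows "p = q"
proof (rule nth_equalityI)
  show "length p = length q" using Rnonneg_decD[OF p] Rnonneg_decD[OF q] by simp
  fix i assume i: "i < length p"
  have eq: "(\<Sum>i<k. p ! i) = (\<Sum>i<k. q ! i)" if "k \<le> n" for k
    using pq that Rnonneg_decD[OF p] Rnonneg_decD[OF q]
    by (auto simp: weak_maj_iff topsum_dec intro!: antisym)
  show "p ! i = q ! i"
    using eq[of i] eq[of "Suc i"] i Rnonneg_decD(1)[OF p] by simp
qed

lemma is_wsup_unique: "is_wsup n S p \<Longrightarrow> is_wsup n S q \<Longrightarrow> p = q"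
  using weak_maj_antisym Rnonneg_decD(4) unfolding is_wsup_def by blast

lemma wsup_eq: "is_wsup n S p \<Longrightarrow> wsup n S = p"
  unfolding wsup_def using is_wsup_unique by blast

lemma is_wsup_member:
  assumes "p \<in> Rnonneg_dec n" "p \<in> S" "\<And>s. s \<in> S \<Longrightarrow> s \<prec>\<^sub>w p"
  shows "is_wsup n S p"
  using assms unfolding is_wsup_def by blast

text \<open>
  The infimum \<open>F k\<close>, over all nonnegative upper bounds, of the sum of the \<open>k\<close> largest entries is again
  nondecreasing and concave in \<open>k\<close>, because each of these sums is. Hence the increments of \<open>F\<close> form a
  nonnegative decreasing vector whose partial sums are \<open>F\<close>.
\<close>
lemma ex_wsup:
  assumes ub: "u \<in> Rnonneg n" "\<And>s. s \<in> S \<Longrightarrow> s \<prec>\<^sub>w u" and ne: "S \<noteq> {}"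
  shows "\<exists>p. is_wsup n S p"
proof -
  define U where "U = {q \<in> Rnonneg n. \<forall>s\<in>S. s \<prec>\<^sub>w q}"
  define F where "F k = (INF q\<in>U. topsum k q)" for k
  have uU: "u \<in> U" using ub by (simp add: U_def)
  have dec: "dec_rearr q ! i \<ge> 0" "i \<le> j \<Longrightarrow> j < n \<Longrightarrow> dec_rearr q ! j \<le> dec_rearr q ! i"
    if "q \<in> U" "i < n" for q i j
  proof -
    have "length q = n" "\<forall>a\<in>set (dec_rearr q). 0 \<le> a"
      using that by (auto simp: U_def Rnonneg_def dec_rearr_def)
    then have "dec_rearr q \<in> Rnonneg_dec n"
      using dec_rearr_dec by (simp add: Rnonneg_dec_def Rnonneg_def)
    from Rnonneg_decD(3,5)[OF this] that
    show "dec_rearr q ! i \<ge> 0" "i \<le> j \<Longrightarrow> j < n \<Longrightarrow> dec_rearr q ! j \<le> dec_rearr q ! i"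
      by blast+
  qed
  have len: "length q = n" if "q \<in> U" for q using that by (simp add: U_def Rnonneg_def)
  have nn: "0 \<le> topsum k q" if "k \<le> n" "q \<in> U" for k q
    using dec(1)[OF that(2)] that by (auto simp: topsum_nth len intro!: sum_nonneg)
  have F_le: "F k \<le> topsum k q" if "k \<le> n" "q \<in> U" for k q
    unfolding F_def by (rule cINF_lower[OF bdd_belowI[of _ 0]]) (use that nn in auto)
  have F_ge: "c \<le> F k" if "\<And>q. q \<in> U \<Longrightarrow> c \<le> topsum k q" for c k
    unfolding F_def by (rule cINF_greatest) (use that uU in auto)
  have F0: "F 0 = 0"
    using F_le[of 0 u] F_ge[of 0 0] uU by (simp add: topsum_def)
  have mono: "F k \<le> F (Suc k)" if k: "Suc k \<le> n" for k
  proof (rule F_ge)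
    fix q assume q: "q \<in> U"
    then show "F k \<le> topsum (Suc k) q"
      using F_le[of k q] dec(1)[OF q, of k] k by (simp add: topsum_nth len)
  qed
  have concave: "F (Suc (Suc k)) - F (Suc k) \<le> F (Suc k) - F k" if k: "Suc (Suc k) \<le> n" for k
  proof -
    have "(F (Suc (Suc k)) + F k) / 2 \<le> F (Suc k)"
    proof (rule F_ge)
      fix q assume q: "q \<in> U"
      then show "(F (Suc (Suc k)) + F k) / 2 \<le> topsum (Suc k) q"
        using F_le[of k q] F_le[of "Suc (Suc k)" q] dec(2)[OF q, of k "Suc k"] k
        by (simp add: topsum_nth len)
    qed
    then show ?thesis by simp
  qed
  define p where "p = map (\<lambda>i. F (Suc i) - F i) [0..<n]"
  have len_p: "length p = n" by (simp add: p_def)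
  have dec_p: "sorted_wrt (\<ge>) p"
  proof -
    have "F (Suc j) - F j \<le> F (Suc i) - F i" if "i \<le> j" "j < n" for i j
      using that
    proof (induction j rule: dec_induct)
      case (step j)
      then show ?case using concave[of j] by simp
    qed simp
    then show ?thesis by (auto simp: p_def sorted_wrt_iff_nth_less)
  qed
  have p: "p \<in> Rnonneg_dec n"
    using dec_p mono by (auto simp: Rnonneg_dec_def Rnonneg_def p_def)
  have top_p: "topsum k p = F k" if "k \<le> n" for k
  proof -
    have "topsum k p = (\<Sum>i<k. F (Suc i) - F i)"
      using that dec_p by (simp add: topsum_dec len_p) (simp add: p_def)
    then show ?thesis by (simp add: sum_lessThan_telescope F0)
  qed
  have "s \<prec>\<^sub>w p" if "s \<in> S" for s
  proof -
    have "length s = n" using ub(2)[OF that] ub(1) by (simp add: weak_maj_iff Rnonneg_def)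
    then show ?thesis
      using that by (auto simp: weak_maj_iff len_p top_p U_def intro!: F_ge)
  qed
  moreover have "p \<prec>\<^sub>w q" if "q \<in> U" for q
    using that F_le by (simp add: weak_maj_iff len_p top_p len)
  ultimately have "is_wsup n S p" using p unfolding is_wsup_def U_def by blast
  then show ?thesis by blast
qed

lemma ex_wjoin:
  assumes r: "r \<in> Rnonneg_dec n" and s: "s \<in> Rnonneg_dec n"
  shows "\<exists>p. is_wsup n {r, s} p"
proof -
  note R = Rnonneg_decD[OF r] and S = Rnonneg_decD[OF s]
  define u where "u = map (\<lambda>i. r ! i + s ! i) [0..<n]"
  have u: "u \<in> Rnonneg_dec n"
    using R(3,5) S(3,5) by (auto simp: u_def Rnonneg_dec_def Rnonneg_def sorted_wrt_iff_nth_less add_mono)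
  note U = Rnonneg_decD[OF u]
  have "r \<prec>\<^sub>w u" "s \<prec>\<^sub>w u"
    using R S U by (auto simp: weak_maj_iff topsum_dec u_def intro!: sum_mono)
  then show ?thesis using ex_wsup[OF U(4), of "{r, s}"] by auto
qed

text \<open>
  Shifting \<open>z\<close> by its \<open>k\<close>-th largest value changes both sides equally, and afterwards every term of
  the difference has the right sign.
\<close>
lemma weighted_sum_le_top:
  fixes z w :: "nat \<Rightarrow> real"
  assumes dec: "\<And>i j. i \<le> j \<Longrightarrow> j < N \<Longrightarrow> z j \<le> z i"
    and w: "\<And>i. i < N \<Longrightarrow> 0 \<le> w i" "\<And>i. i < N \<Longrightarrow> w i \<le> 1"
    and k: "k \<le> N" "(\<Sum>i<N. w i) = real k"
  shows "(\<Sum>i<N. z i * w i) \<le> (\<Sum>i<k. z i)"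
proof -
  have k_sum: "(\<Sum>i<N. of_bool (i < k) * g i) = (\<Sum>i<k. g i)" for g :: "nat \<Rightarrow> real"
    by (rule sum.mono_neutral_cong_right) (use k(1) in auto)
  \<comment> \<open>For \<open>k = 0\<close> the shift is by \<open>z 0\<close>, which is harmless because all weights vanish.\<close>
  have "(\<Sum>i<N. (z i - z (k - 1)) * (w i - of_bool (i < k))) \<le> 0"
  proof (rule sum_nonpos)
    fix i assume "i \<in> {..<N}"
    then have i: "i < N" by simp
    show "(z i - z (k - 1)) * (w i - of_bool (i < k)) \<le> 0"
    proof (cases "i < k")
      case True
      then show ?thesis
        using dec[of i "k - 1"] w(2)[OF i] k(1) by (intro mult_nonneg_nonpos) auto
    next
      case False
      show ?thesis
      proof (cases "k = 0")
        case True
        then have "w i = 0" using k(2) w(1) i sum_nonneg_eq_0_iff[of "{..<N}" w] by simp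
        then show ?thesis using True by simp
      next
        case k0: False
        then show ?thesis using dec[of "k - 1" i] w(1)[OF i] False i by (intro mult_nonpos_nonneg) auto
      qed
    qed
  qed
  moreover have "(\<Sum>i<N. (z i - z (k - 1)) * (w i - of_bool (i < k))) =
    (\<Sum>i<N. z i * w i) - (\<Sum>i<N. of_bool (i < k) * z i)
    - z (k - 1) * ((\<Sum>i<N. w i) - (\<Sum>i<N. of_bool (i < k) * 1))"
    unfolding sum_subtractf[symmetric] sum_distrib_left
    by (rule sum.cong) (simp_all add: algebra_simps)
  ultimately show ?thesis unfolding k_sum k(2) by simp
qed

lemma abel_le:
  fixes a s t :: "nat \<Rightarrow> real"
  assumes dec: "\<And>i. Suc i < N \<Longrightarrow> a (Suc i) \<le> a i" and nn: "\<And>i. i < N \<Longrightarrow> 0 \<le> a i"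
    and le: "\<And>k. k \<le> N \<Longrightarrow> (\<Sum>i<k. s i) \<le> (\<Sum>i<k. t i)"
  shows "(\<Sum>i<N. a i * s i) \<le> (\<Sum>i<N. a i * t i)"
proof -
  have key: "a m * (\<Sum>i<Suc m. t i - s i) \<le> (\<Sum>i<Suc m. a i * (t i - s i))" if "m < N" for m
    using that
  proof (induction m)
    case (Suc m)
    let ?D = "\<Sum>i<Suc m. t i - s i"
    have "0 \<le> ?D" using le[of "Suc m"] Suc.prems by (simp add: sum_subtractf)
    then have "a (Suc m) * ?D \<le> a m * ?D" using dec Suc.prems by (intro mult_right_mono) auto
    then show ?case
      using Suc by (simp only: sum.lessThan_Suc[of _ "Suc m"] distrib_left) simp
  qed simp
  show ?thesis
  proof (cases N)
    case (Suc m)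
    have "0 \<le> a m * (\<Sum>i<Suc m. t i - s i)"
      using le[of N] nn[of m] Suc by (intro mult_nonneg_nonneg) (simp_all add: sum_subtractf)
    also have "\<dots> \<le> (\<Sum>i<Suc m. a i * (t i - s i))" using key Suc by simp
    finally show ?thesis unfolding Suc by (simp add: right_diff_distrib sum_subtractf)
  qed simp
qed

lemma length_cprod [simp]: "length (p \<star> q) = min (length p) (length q)"
  by (simp add: cprod_def)

lemma nth_cprod: "i < length p \<Longrightarrow> i < length q \<Longrightarrow> (p \<star> q) ! i = p ! i * q ! i"
  by (simp add: cprod_def)

lemma cprod_Rnonneg_dec:
  assumes "p \<in> Rnonneg_dec n" "q \<in> Rnonneg_dec n" shows "p \<star> q \<in> Rnonneg_dec n"
proof -
  note P = Rnonneg_decD[OF assms(1)] and Q = Rnonneg_decD[OF assms(2)]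
  have "sorted_wrt (\<ge>) (p \<star> q)"
    using P Q by (auto simp: sorted_wrt_iff_nth_less nth_cprod intro!: mult_mono)
  moreover have "0 \<le> a" if "a \<in> set (p \<star> q)" for a
    using that P Q by (auto simp: in_set_conv_nth nth_cprod)
  ultimately show ?thesis using P(1) Q(1) by (simp add: Rnonneg_dec_def Rnonneg_def)
qed

section \<open>The symmetric cone and the variational principle of Ky Fan\<close>

context trace_form_jordan_algebra begin

abbreviation lam :: "'a \<Rightarrow> real list" where "lam x \<equiv> eigvals jp e x"
abbreviation K :: "'a set" where "K \<equiv> symmetric_cone jp e"
abbreviation n :: nat where "n \<equiv> jrank jp e"

lemma spectral_theorem_sorted:
  obtains as cs where "spectral_decomp jp e x as cs" "lam x = as" "sorted_wrt (\<ge>) as"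
  using spectral_theorem[of x "\<lambda>t. t"] eigvals_eq by (metis map_ident)

lemma lam_length: "length (lam x) = n"
proof -
  obtain as cs where d: "spectral_decomp jp e x as cs" and "lam x = as"
    by (rule spectral_theorem_sorted)
  then show ?thesis using spectral_decompD(1,2)[OF d] jrank_eq by simp
qed

lemma lam_dec: "sorted_wrt (\<ge>) (lam x)"
  by (rule spectral_theorem_sorted[of x]) simp

lemma lam_comb:
  assumes cs: "jordan_frame jp e cs" and dec: "\<And>i j. i < j \<Longrightarrow> j < length cs \<Longrightarrow> a j \<le> a i"
  shows "lam (comb cs a) = map a [0..<length cs]"
  using eigvals_eq[OF spectral_decompI[OF cs]] dec by (simp add: sorted_wrt_iff_nth_less)

lemma jabs_comb:
  assumes "jordan_frame jp e cs"
  shows "jabs jp e (comb cs a) = comb cs (\<lambda>i. \<bar>a i\<bar>)"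
  by (simp add: jabs_eq[OF spectral_decompI[OF assms]])

lemma comb_inner_frame:
  assumes cs: "jordan_frame jp e cs" and i: "i < length cs"
  shows "comb cs a \<bullet> cs ! i = a i"
proof -
  have "comb cs a \<bullet> cs ! i = jp (cs ! i) (comb cs a) \<bullet> e"
    using inner_unit[of "cs ! i" "comb cs a"] by (simp add: inner_commute)
  then show ?thesis by (simp add: frame_comb[OF cs i] frame_inner_unit[OF cs i])
qed

text \<open>
  Frame elements are idempotents and have nonnegative inner products, so nonnegative coordinates along
  one frame force nonnegative coordinates along any other.
\<close>
lemma cone_comb_iff:
  assumes cs: "jordan_frame jp e cs"
  shows "comb cs a \<in> K \<longleftrightarrow> (\<forall>i<length cs. 0 \<le> a i)"
proof
  assume "comb cs a \<in> K"
  obtain bs ds where d: "spectral_decomp jp e (comb cs a) bs ds" and "lam (comb cs a) = bs"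
    by (rule spectral_theorem_sorted)
  with \<open>comb cs a \<in> K\<close> have bs: "\<forall>b\<in>set bs. 0 \<le> b" by (simp add: symmetric_cone_def)
  note D = spectral_decompD[OF d]
  show "\<forall>i<length cs. 0 \<le> a i"
  proof (intro allI impI)
    fix i assume i: "i < length cs"
    have "0 \<le> (\<Sum>j<length ds. bs ! j * (ds ! j \<bullet> cs ! i))"
      using bs D(2) frame_idempotent(1)[OF D(1)] frame_idempotent(1)[OF cs i]
      by (intro sum_nonneg mult_nonneg_nonneg inner_idempotents_nonneg) auto
    also have "\<dots> = comb cs a \<bullet> cs ! i" unfolding D(3) by (simp add: inner_sum_left)
    also have "\<dots> = a i" by (rule comb_inner_frame[OF cs i])
    finally show "0 \<le> a i" .
  qed
next
  assume a: "\<forall>i<length cs. 0 \<le> a i"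
  obtain bs ds where d: "spectral_decomp jp e (comb cs a) bs ds" and lam: "lam (comb cs a) = bs"
    by (rule spectral_theorem_sorted)
  note D = spectral_decompD[OF d]
  have "0 \<le> bs ! j" if j: "j < length ds" for j
  proof -
    have "0 \<le> (\<Sum>i<length cs. a i * (cs ! i \<bullet> ds ! j))"
      using a frame_idempotent(1)[OF cs] frame_idempotent(1)[OF D(1) j]
      by (intro sum_nonneg mult_nonneg_nonneg inner_idempotents_nonneg) auto
    also have "\<dots> = comb cs a \<bullet> ds ! j" by (simp add: inner_sum_left)
    also have "\<dots> = bs ! j" unfolding D(3) by (rule comb_inner_frame[OF D(1) j])
    finally show ?thesis .
  qed
  then show "comb cs a \<in> K" using lam D(2) by (auto simp: symmetric_cone_def in_set_conv_nth)
qed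

lemma cone_square: "jp u u \<in> K"
proof -
  obtain as cs where "spectral_decomp jp e u as cs" by (rule spectral_theorem_sorted)
  note D = spectral_decompD[OF this]
  show ?thesis unfolding D(3) comb_mult[OF D(1)] cone_comb_iff[OF D(1)] by simp
qed

text \<open>
  Multiplication by an idempotent is positive semidefinite and frame elements are squares. In this form
  it is evident that the symmetric cone is convex.
\<close>
lemma cone_self_dual: "x \<in> K \<longleftrightarrow> (\<forall>u. 0 \<le> x \<bullet> jp u u)"
proof -
  obtain as cs where "spectral_decomp jp e x as cs" by (rule spectral_theorem_sorted)
  note D = spectral_decompD[OF this]
  have "0 \<le> x \<bullet> jp u u" if "x \<in> K" for u
  proof -
    have "x \<bullet> jp u u = (\<Sum>i<length cs. as ! i * (jp (cs ! i) u \<bullet> u))"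
      unfolding D(3) by (simp add: inner_jp jp_sum_left jp_simps inner_sum_left)
    also have "\<dots> \<ge> 0"
      using that frame_idempotent(1)[OF D(1)] unfolding D(3) cone_comb_iff[OF D(1)]
      by (intro sum_nonneg mult_nonneg_nonneg jp_idempotent_nonneg) auto
    finally show ?thesis .
  qed
  moreover have "x \<in> K" if x: "\<forall>u. 0 \<le> x \<bullet> jp u u"
  proof -
    have "0 \<le> as ! i" if i: "i < length cs" for i
    proof -
      have "as ! i = x \<bullet> cs ! i" unfolding D(3) by (rule comb_inner_frame[OF D(1) i, symmetric])
      also have "\<dots> \<ge> 0"
        using x[rule_format, of "cs ! i"] frame_idempotent(1)[OF D(1) i] by simp
      finally show ?thesis .
    qed
    then show ?thesis unfolding D(3) cone_comb_iff[OF D(1)] by simp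
  qed
  ultimately show ?thesis by blast
qed

lemma cone_add: "x \<in> K \<Longrightarrow> y \<in> K \<Longrightarrow> x + y \<in> K"
  by (simp add: cone_self_dual inner_add_left)

lemma cone_scale: "x \<in> K \<Longrightarrow> 0 \<le> t \<Longrightarrow> t *\<^sub>R x \<in> K"
  by (simp add: cone_self_dual)

lemma cone_inner_nonneg:
  assumes x: "x \<in> K" and y: "y \<in> K" shows "0 \<le> x \<bullet> y"
proof -
  obtain as cs where "spectral_decomp jp e y as cs" by (rule spectral_theorem_sorted)
  note D = spectral_decompD[OF this]
  have "0 \<le> x \<bullet> cs ! i" if "i < length cs" for i
    using x[unfolded cone_self_dual, rule_format, of "cs ! i"] frame_idempotent(1)[OF D(1) that] by simp
  then have "0 \<le> (\<Sum>i<length cs. as ! i * (x \<bullet> cs ! i))"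
    using y unfolding D(3) cone_comb_iff[OF D(1)] by (intro sum_nonneg mult_nonneg_nonneg) auto
  then show ?thesis unfolding D(3) by (simp add: inner_sum_right)
qed

lemma lam_cone: "x \<in> K \<Longrightarrow> lam x \<in> Rnonneg_dec n"
  by (simp add: Rnonneg_dec_def Rnonneg_def lam_length lam_dec symmetric_cone_def)

lemma jabs_cone: "x \<in> K \<Longrightarrow> jabs jp e x = x"
proof -
  assume x: "x \<in> K"
  obtain as cs where "spectral_decomp jp e x as cs" by (rule spectral_theorem_sorted)
  note D = spectral_decompD[OF this]
  show "jabs jp e x = x"
    using x unfolding D(3) jabs_comb[OF D(1)] cone_comb_iff[OF D(1)]
    by (intro sum.cong) auto
qed

lemma jabs_bounds: "jabs jp e x - x \<in> K" "jabs jp e x + x \<in> K" "jabs jp e x \<in> K"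
proof -
  obtain as cs where "spectral_decomp jp e x as cs" by (rule spectral_theorem_sorted)
  note D = spectral_decompD[OF this]
  show "jabs jp e x - x \<in> K" "jabs jp e x + x \<in> K" "jabs jp e x \<in> K"
    unfolding D(3) jabs_comb[OF D(1)] sum_subtractf[symmetric] sum.distrib[symmetric]
      scaleR_diff_left[symmetric] scaleR_add_left[symmetric] cone_comb_iff[OF D(1)]
    by auto
qed

lemma unit_cone: "e \<in> K"
  using cone_square[of e] by (simp add: jp_unit)

lemma frame_prefix:
  assumes cs: "jordan_frame jp e cs" and k: "k \<le> length cs"
  shows "(\<Sum>i<k. cs ! i) = comb cs (\<lambda>i. of_bool (i < k))"
  by (rule sum.mono_neutral_cong_left) (use k in auto)

lemma frame_prefix_cone:
  assumes cs: "jordan_frame jp e cs" and k: "k \<le> length cs"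
  shows "(\<Sum>i<k. cs ! i) \<in> K" "e - (\<Sum>i<k. cs ! i) \<in> K"
proof -
  note p = frame_prefix[OF cs k]
  have ep: "e - (\<Sum>i<k. cs ! i) = comb cs (\<lambda>i. of_bool (\<not> i < k))"
    unfolding p comb_one[OF cs, symmetric] sum_subtractf[symmetric] by (rule sum.cong) auto
  show "(\<Sum>i<k. cs ! i) \<in> K" "e - (\<Sum>i<k. cs ! i) \<in> K"
    unfolding ep unfolding p cone_comb_iff[OF cs] by simp_all
qed

text \<open>
  In a frame \<open>d\<close> that diagonalizes \<open>z\<close>, the left side is \<open>\<Sum>z\<^sub>j w\<^sub>j\<close> with weights \<open>w\<^sub>j = d\<^sub>j \<bullet> p\<close>, where
  \<open>p\<close> is the sum of the first \<open>k\<close> elements of \<open>cs\<close>. The weights lie in \<open>[0, 1]\<close> and sum to \<open>k\<close>.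
\<close>
lemma ky_fan:
  assumes cs: "jordan_frame jp e cs" and k: "k \<le> n"
  shows "(\<Sum>i<k. z \<bullet> cs ! i) \<le> topsum k (lam z)"
proof -
  obtain as ds where d: "spectral_decomp jp e z as ds" and lam: "lam z = as"
    and dec: "sorted_wrt (\<ge>) as"
    by (rule spectral_theorem_sorted)
  note D = spectral_decompD[OF d]
  have len: "length cs = n" "length ds = n" "length as = n"
    using jrank_eq[OF cs] jrank_eq[OF D(1)] D(2) by simp_all
  define p where "p = (\<Sum>i<k. cs ! i)"
  have pK: "p \<in> K" "e - p \<in> K"
    using frame_prefix_cone[OF cs, of k] k len by (simp_all add: p_def)
  have dK: "ds ! i \<in> K" if "i < n" for i
    using cone_square[of "ds ! i"] frame_idempotent(1)[OF D(1)] that len by simp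
  have "(\<Sum>i<k. z \<bullet> cs ! i) = z \<bullet> p" by (simp add: p_def inner_sum_right)
  also have "\<dots> = (\<Sum>i<n. as ! i * (ds ! i \<bullet> p))" by (simp add: D(3) inner_sum_left len)
  also have "\<dots> \<le> (\<Sum>i<k. as ! i)"
  proof (rule weighted_sum_le_top)
    fix i assume i: "i < n"
    show "0 \<le> ds ! i \<bullet> p" using cone_inner_nonneg dK[OF i] pK by blast
    have "0 \<le> ds ! i \<bullet> (e - p)" using cone_inner_nonneg dK[OF i] pK by blast
    then show "ds ! i \<bullet> p \<le> 1"
      using frame_inner_unit[OF D(1), of i] i len by (simp add: inner_diff_right)
  next
    have "(\<Sum>i<n. ds ! i \<bullet> p) = e \<bullet> p"
      using comb_one[OF D(1)] by (simp add: len flip: inner_sum_left)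
    also have "\<dots> = (\<Sum>i<k. cs ! i \<bullet> e)" by (simp add: p_def inner_sum_right inner_commute)
    also have "\<dots> = real k" using frame_inner_unit[OF cs] k len by simp
    finally show "(\<Sum>i<n. ds ! i \<bullet> p) = real k" .
  next
    fix i j assume "i \<le> j" "j < n"
    then show "as ! j \<le> as ! i"
      using dec sorted_wrt_nth_less[OF dec, of i j] len by (cases "i = j") auto
  qed (rule k)
  also have "\<dots> = topsum k (lam z)" using dec k len by (simp add: lam topsum_dec)
  finally show ?thesis .
qed

lemma ky_fan_attained:
  obtains cs where "jordan_frame jp e cs" "length cs = n"
    "\<forall>k\<le>n. (\<Sum>i<k. z \<bullet> cs ! i) = topsum k (lam z)"
proof -
  obtain as cs where d: "spectral_decomp jp e z as cs" and lam: "lam z = as"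
    and dec: "sorted_wrt (\<ge>) as"
    by (rule spectral_theorem_sorted)
  note D = spectral_decompD[OF d]
  have len: "length cs = n" using jrank_eq[OF D(1)] by simp
  have "z \<bullet> cs ! i = as ! i" if "i < n" for i
    unfolding D(3) using comb_inner_frame[OF D(1), of i "(!) as"] that len by simp
  then have "(\<Sum>i<k. z \<bullet> cs ! i) = topsum k (lam z)" if "k \<le> n" for k
    using dec that len D(2) by (simp add: lam topsum_dec)
  then show ?thesis using that D(1) len by blast
qed

text \<open>
  In a frame \<open>cs\<close> that diagonalizes \<open>y\<close> with decreasing absolute eigenvalues, the order relation
  bounds the \<open>i\<close>-th of them by \<open>z \<bullet> cs ! i\<close>, and Ky Fan's inequality applies to \<open>z\<close>.
\<close>
lemma weak_maj_of_order:
  assumes "z - y \<in> K" "z + y \<in> K"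
  shows "lam (jabs jp e y) \<prec>\<^sub>w lam z"
proof -
  obtain as cs where d: "spectral_decomp jp e y as cs" and dec: "sorted_wrt (\<ge>) (map abs as)"
    by (rule spectral_theorem)
  note D = spectral_decompD[OF d]
  have len: "length cs = n" using jrank_eq[OF D(1)] by simp
  have dec': "\<bar>as ! j\<bar> \<le> \<bar>as ! i\<bar>" if "i < j" "j < length cs" for i j
    using sorted_wrt_nth_less[OF dec, of i j] that D(2) by simp
  have lam: "lam (jabs jp e y) = map (\<lambda>i. \<bar>as ! i\<bar>) [0..<n]"
    unfolding jabs_eq[OF d] by (subst lam_comb[OF D(1)]) (use dec' len in auto)
  have le: "\<bar>as ! i\<bar> \<le> z \<bullet> cs ! i" if i: "i < n" for i
  proof -
    have "cs ! i \<in> K" using cone_square[of "cs ! i"] frame_idempotent(1)[OF D(1)] i len by simp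
    then have "0 \<le> (z - y) \<bullet> cs ! i" "0 \<le> (z + y) \<bullet> cs ! i"
      using assms cone_inner_nonneg by blast+
    moreover have "y \<bullet> cs ! i = as ! i"
      unfolding D(3) using comb_inner_frame[OF D(1)] i len by simp
    ultimately show ?thesis by (simp add: inner_diff_left inner_add_left)
  qed
  have "topsum k (lam (jabs jp e y)) \<le> topsum k (lam z)" if k: "k \<le> n" for k
  proof -
    have "topsum k (lam (jabs jp e y)) = (\<Sum>i<k. \<bar>as ! i\<bar>)"
      using k topsum_dec[OF lam_dec, of k "jabs jp e y"] by (simp add: lam_length) (simp add: lam)
    also have "\<dots> \<le> (\<Sum>i<k. z \<bullet> cs ! i)" using le k by (intro sum_mono) auto
    also have "\<dots> \<le> topsum k (lam z)" by (rule ky_fan[OF D(1) k])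
    finally show ?thesis .
  qed
  then show ?thesis by (simp add: weak_maj_iff lam_length)
qed

section \<open>The order interval of the unit\<close>

text \<open>
  The closed unit ball of the spectral norm.
\<close>
definition order_unit_ball :: "'a set" where
  "order_unit_ball = {x. e - x \<in> K \<and> e + x \<in> K}"

lemma order_unit_ball_square:
  assumes "2 *\<^sub>R e - w \<in> K" "2 *\<^sub>R e + w \<in> K"
  shows "4 *\<^sub>R e - jp w w \<in> K"
proof -
  obtain as cs where "spectral_decomp jp e w as cs" by (rule spectral_theorem_sorted)
  note D = spectral_decompD[OF this]
  have c: "t *\<^sub>R e = comb cs (\<lambda>_. t)" for t
    unfolding comb_one[OF D(1), symmetric] by (simp add: scaleR_sum_right)
  have a: "\<bar>as ! i\<bar> \<le> 2" if "i < length cs" for i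
    using assms that
    unfolding D(3) c sum_subtractf[symmetric] sum.distrib[symmetric]
      scaleR_diff_left[symmetric] scaleR_add_left[symmetric] cone_comb_iff[OF D(1)]
    by (auto simp: abs_le_iff)
  have "as ! i * as ! i \<le> 4" if "i < length cs" for i
    using abs_le_square_iff[of "as ! i" 2] a[OF that] by (simp add: power2_eq_square)
  then show ?thesis
    unfolding D(3) comb_mult[OF D(1)] c sum_subtractf[symmetric]
      scaleR_diff_left[symmetric] cone_comb_iff[OF D(1)] by simp
qed

text \<open>
  The spectral norm is submultiplicative by polarization:
  \<open>4(e - x \<circ> y) = (4e - (x + y)\<^sup>2) + (x - y)\<^sup>2\<close> is a sum of two elements of the cone, and likewise
  \<open>4(e + x \<circ> y)\<close>.
\<close>
lemma order_unit_ball_jp: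
  assumes "x \<in> order_unit_ball" "y \<in> order_unit_ball"
  shows "jp x y \<in> order_unit_ball"
proof -
  have x: "e - x \<in> K" "e + x \<in> K" and y: "e - y \<in> K" "e + y \<in> K"
    using assms by (auto simp: order_unit_ball_def)
  have "2 *\<^sub>R e - (x + y) \<in> K" "2 *\<^sub>R e + (x + y) \<in> K"
    "2 *\<^sub>R e - (x - y) \<in> K" "2 *\<^sub>R e + (x - y) \<in> K"
    using cone_add[OF x(1) y(1)] cone_add[OF x(2) y(2)] cone_add[OF x(1) y(2)] cone_add[OF x(2) y(1)]
    by (simp_all add: scaleR_2 algebra_simps)
  then have p: "4 *\<^sub>R e - jp (x + y) (x + y) \<in> K" and m: "4 *\<^sub>R e - jp (x - y) (x - y) \<in> K"
    using order_unit_ball_square by blast+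
  have xy: "4 *\<^sub>R jp x y = jp (x + y) (x + y) - jp (x - y) (x - y)"
    by (simp add: jp_simps jp_commute[of y x] scaleR_left_distrib[of 2 2, simplified] scaleR_2 algebra_simps)
  have "4 *\<^sub>R (e - jp x y) \<in> K"
    using cone_add[OF p cone_square[of "x - y"]] by (simp add: scaleR_diff_right xy algebra_simps)
  moreover have "4 *\<^sub>R (e + jp x y) \<in> K"
    using cone_add[OF m cone_square[of "x + y"]] by (simp add: scaleR_add_right xy algebra_simps)
  ultimately show ?thesis
    using cone_scale[of "4 *\<^sub>R (e - jp x y)" "1/4"] cone_scale[of "4 *\<^sub>R (e + jp x y)" "1/4"]
    by (simp add: order_unit_ball_def)
qed

lemma idempotent_order_unit_ball: "c \<in> idempotents jp \<Longrightarrow> c \<in> order_unit_ball"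
proof -
  assume "c \<in> idempotents jp"
  then have cc: "jp c c = c" by (simp add: idempotents_def)
  have "jp (e - c) (e - c) = e - c" by (simp add: jp_simps jp_unit jp_unit_right cc)
  then show ?thesis
    using cone_square[of "e - c"] cone_square[of c] cone_add[OF unit_cone, of c] cc
    by (simp add: order_unit_ball_def)
qed

lemma unit_root_order_unit_ball: "\<epsilon> \<in> unit_roots jp e \<Longrightarrow> \<epsilon> \<in> order_unit_ball"
proof -
  assume "\<epsilon> \<in> unit_roots jp e"
  then have ee: "jp \<epsilon> \<epsilon> = e" by (simp add: unit_roots_def)
  have "jp (e - \<epsilon>) (e - \<epsilon>) = 2 *\<^sub>R (e - \<epsilon>)" "jp (e + \<epsilon>) (e + \<epsilon>) = 2 *\<^sub>R (e + \<epsilon>)"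
    by (simp_all add: jp_simps jp_unit jp_unit_right ee scaleR_2)
  then have "2 *\<^sub>R (e - \<epsilon>) \<in> K" "2 *\<^sub>R (e + \<epsilon>) \<in> K" by (metis cone_square)+
  then show ?thesis
    using cone_scale[of "2 *\<^sub>R (e - \<epsilon>)" "1/2"] cone_scale[of "2 *\<^sub>R (e + \<epsilon>)" "1/2"]
    by (simp add: order_unit_ball_def)
qed

lemma unit_nonzero: "e \<noteq> 0"
proof
  assume "e = 0"
  then have "x = 0" for x :: 'a using jp_unit[of x] by (simp add: jp_simps)
  then show False using nonempty_Basis nonzero_Basis by blast
qed

section \<open>Positive maps\<close>

context
  fixes T :: "'a \<Rightarrow> 'a"
  assumes lin: "linear T" and pos: "\<And>x. x \<in> K \<Longrightarrow> T x \<in> K"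
begin

lemma adjoint_pos: "x \<in> K \<Longrightarrow> adjoint T x \<in> K"
  unfolding cone_self_dual[of "adjoint T x"]
  by (metis adjoint_clauses(2) cone_inner_nonneg cone_square lin pos)

lemma positive_weak_maj:
  assumes "z - y \<in> K" "z + y \<in> K"
  shows "lam (jabs jp e (T y)) \<prec>\<^sub>w lam (T z)"
  using pos[OF assms(1)] pos[OF assms(2)]
  by (intro weak_maj_of_order) (simp_all add: linear_diff[OF lin] linear_add[OF lin])

text \<open>
  The product of \<open>c\<close> and \<open>\<epsilon>\<close> lies between \<open>-e\<close> and \<open>e\<close>, so order comparison makes \<open>lam (T e)\<close> an
  upper bound, and \<open>c = \<epsilon> = e\<close> attains it.
\<close>
lemma is_wsup_image:
  "is_wsup n {lam (jabs jp e (T (jp c \<epsilon>))) | c \<epsilon>. c \<in> idempotents jp \<and> \<epsilon> \<in> unit_roots jp e} (lam (T e))"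
proof (rule is_wsup_member)
  show "lam (T e) \<in> Rnonneg_dec n" using lam_cone pos unit_cone by blast
  have "lam (T e) = lam (jabs jp e (T (jp e e)))"
    using jabs_cone[OF pos[OF unit_cone]] by (simp add: jp_unit)
  moreover have "e \<in> idempotents jp" "e \<in> unit_roots jp e"
    using unit_nonzero by (simp_all add: idempotents_def unit_roots_def jp_unit)
  ultimately show "lam (T e) \<in> {lam (jabs jp e (T (jp c \<epsilon>))) | c \<epsilon>.
      c \<in> idempotents jp \<and> \<epsilon> \<in> unit_roots jp e}"
    by blast
next
  fix s assume "s \<in> {lam (jabs jp e (T (jp c \<epsilon>))) | c \<epsilon>. c \<in> idempotents jp \<and> \<epsilon> \<in> unit_roots jp e}"
  then obtain c \<epsilon> where s: "s = lam (jabs jp e (T (jp c \<epsilon>)))"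
    and c: "c \<in> idempotents jp" "\<epsilon> \<in> unit_roots jp e" by blast
  have "jp c \<epsilon> \<in> order_unit_ball"
    using c idempotent_order_unit_ball unit_root_order_unit_ball order_unit_ball_jp by blast
  then show "s \<prec>\<^sub>w lam (T e)"
    unfolding s order_unit_ball_def by (intro positive_weak_maj) auto
qed

text \<open>
  With \<open>|x| = \<Sum>a\<^sub>i c\<^sub>i\<close>, \<open>a\<close> decreasing, and \<open>p\<close> the sum of \<open>m\<close> frame elements attaining Ky Fan's bound
  for \<open>T |x|\<close>, the sum of the \<open>m\<close> largest eigenvalues of \<open>T |x|\<close> is \<open>\<Sum>a\<^sub>i t\<^sub>i\<close> with
  \<open>t\<^sub>i = T c\<^sub>i \<bullet> p\<close>. The partial sums of \<open>t\<close> are controlled by \<open>T* e\<close> up to \<open>m\<close> and by \<open>T e\<close> from \<open>m\<close>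
  on. Summation by parts compares \<open>t\<close> with the vector \<open>h\<close> cut off after \<open>m\<close> entries.
\<close>
lemma positive_multiplicative_bound:
  assumes h: "h \<in> Rnonneg_dec n" and r: "lam (T e) \<prec>\<^sub>w h" and s: "lam (adjoint T e) \<prec>\<^sub>w h"
  shows "lam (jabs jp e (T x)) \<prec>\<^sub>w h \<star> lam (jabs jp e x)"
proof -
  obtain as cs where d: "spectral_decomp jp e x as cs" and dec: "sorted_wrt (\<ge>) (map abs as)"
    by (rule spectral_theorem)
  note D = spectral_decompD[OF d] and H = Rnonneg_decD[OF h]
  have len: "length cs = n" using jrank_eq[OF D(1)] by simp
  have dec': "\<bar>as ! j\<bar> \<le> \<bar>as ! i\<bar>" if "i < j" "j < length cs" for i j
    using sorted_wrt_nth_less[OF dec, of i j] that D(2) by simp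
  let ?y = "jabs jp e x"
  have y: "?y = comb cs (\<lambda>i. \<bar>as ! i\<bar>)" by (rule jabs_eq[OF d])
  have lam_y: "lam ?y = map (\<lambda>i. \<bar>as ! i\<bar>) [0..<n]"
    unfolding y by (subst lam_comb[OF D(1)]) (use dec' len in auto)
  have hy: "h \<star> lam ?y \<in> Rnonneg_dec n"
    by (intro cprod_Rnonneg_dec h lam_cone jabs_bounds)
  have "topsum m (lam (T ?y)) \<le> topsum m (h \<star> lam ?y)" if m: "m \<le> n" for m
  proof -
    obtain ds where ds: "jordan_frame jp e ds" "length ds = n"
      and top: "\<forall>k\<le>n. (\<Sum>i<k. T ?y \<bullet> ds ! i) = topsum k (lam (T ?y))"
      by (rule ky_fan_attained[of "T ?y"])
    define p where "p = (\<Sum>i<m. ds ! i)"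
    have pK: "p \<in> K" "e - p \<in> K"
      using frame_prefix_cone[OF ds(1), of m] m ds(2) by (simp_all add: p_def)
    define t where "t k = T (cs ! k) \<bullet> p" for k
    define g where "g k = of_bool (k < m) * h ! k" for k
    have cK: "cs ! i \<in> K" if "i < n" for i
      using cone_square[of "cs ! i"] frame_idempotent(1)[OF D(1)] that len by simp
    have t0: "0 \<le> t i" if "i < n" for i
      unfolding t_def by (intro cone_inner_nonneg pos cK pK that)
    have g_sum: "(\<Sum>i<k. g i) = topsum (min k m) h" if k: "k \<le> n" for k
    proof -
      have "topsum (min k m) h = (\<Sum>i<min k m. h ! i)"
        using H m by (intro topsum_dec) auto
      also have "\<dots> = (\<Sum>i<k. g i)"
        by (rule sum.mono_neutral_cong_left) (auto simp: g_def)
      finally show ?thesis by simp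
    qed
    have ts: "(\<Sum>i<k. t i) \<le> (\<Sum>i<k. g i)" if k: "k \<le> n" for k
    proof (cases "k \<le> m")
      case True
      have "(\<Sum>i<k. t i) \<le> (\<Sum>i<k. T (cs ! i) \<bullet> e)"
      proof (rule sum_mono)
        fix i assume "i \<in> {..<k}"
        then have "0 \<le> T (cs ! i) \<bullet> (e - p)"
          using k by (intro cone_inner_nonneg pos cK pK) auto
        then show "t i \<le> T (cs ! i) \<bullet> e" by (simp add: t_def inner_diff_right)
      qed
      also have "\<dots> = (\<Sum>i<k. adjoint T e \<bullet> cs ! i)"
        by (simp add: adjoint_clauses[OF lin] inner_commute)
      also have "\<dots> \<le> topsum k (lam (adjoint T e))" by (rule ky_fan[OF D(1) k])
      also have "\<dots> \<le> topsum k h" using s k by (simp add: weak_maj_iff lam_length)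
      finally show ?thesis using g_sum[OF k] True by (simp add: min_absorb1)
    next
      case False
      have "(\<Sum>i<k. t i) \<le> (\<Sum>i<n. t i)" using t0 k by (intro sum_mono2) auto
      also have "\<dots> = T e \<bullet> p"
        using comb_one[OF D(1)]
        by (simp add: t_def len flip: inner_sum_left linear_sum[OF lin])
      also have "\<dots> = (\<Sum>i<m. T e \<bullet> ds ! i)" by (simp add: p_def inner_sum_right)
      also have "\<dots> \<le> topsum m (lam (T e))" by (rule ky_fan[OF ds(1) m])
      also have "\<dots> \<le> topsum m h" using r m by (simp add: weak_maj_iff lam_length)
      finally show ?thesis using g_sum[OF k] False by (simp add: min_absorb2)
    qed
    have "topsum m (lam (T ?y)) = T ?y \<bullet> p"
      using top m by (simp add: p_def inner_sum_right)
    also have "\<dots> = (\<Sum>i<n. \<bar>as ! i\<bar> * t i)"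
      unfolding y by (simp add: linear_sum[OF lin] linear_cmul[OF lin] inner_sum_left t_def len)
    also have "\<dots> \<le> (\<Sum>i<n. \<bar>as ! i\<bar> * g i)"
      by (rule abel_le) (use dec' len ts in auto)
    also have "\<dots> = (\<Sum>i<m. h ! i * \<bar>as ! i\<bar>)"
      by (rule sum.mono_neutral_cong_right) (use m in \<open>auto simp: g_def\<close>)
    also have "\<dots> = topsum m (h \<star> lam ?y)"
      using m H(1) Rnonneg_decD(2)[OF hy]
      by (subst topsum_dec) (auto simp: lam_length nth_cprod, auto simp: lam_y intro!: sum.cong)
    finally show ?thesis .
  qed
  then have "lam (T ?y) \<prec>\<^sub>w h \<star> lam ?y"
    by (simp add: weak_maj_iff lam_length H(1))
  then show ?thesis
    using weak_maj_trans positive_weak_maj[OF jabs_bounds(1,2)] by blast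
qed

lemma multiplicative_bound_unit:
  assumes q: "q \<in> Rnonneg_dec n"
    and bound: "\<And>x. lam (jabs jp e (T x)) \<prec>\<^sub>w q \<star> lam (jabs jp e x)"
  shows "lam (T e) \<prec>\<^sub>w q"
proof -
  obtain as cs where "spectral_decomp jp e e as cs" by (rule spectral_theorem_sorted)
  note D = spectral_decompD[OF this]
  have "lam e = map (\<lambda>_. 1) [0..<n]"
    using lam_comb[OF D(1), of "\<lambda>_. 1"] comb_one[OF D(1)] jrank_eq[OF D(1)] by simp
  then have "q \<star> lam e = q"
    using Rnonneg_decD(1)[OF q] by (intro nth_equalityI) (simp_all add: nth_cprod)
  then show ?thesis using bound[of e] jabs_cone unit_cone pos by simp
qed

text \<open>
  Test the bound on a sum \<open>x\<close> of \<open>k\<close> elements of a frame that diagonalizes the adjoint image of \<open>e\<close>: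
  the eigenvalues of \<open>x\<close> cut \<open>q\<close> off after \<open>k\<close> entries, and the trace of \<open>T x\<close> is the sum of the \<open>k\<close>
  largest eigenvalues of \<open>adjoint T e\<close>.
\<close>
lemma multiplicative_bound_adjoint:
  assumes q: "q \<in> Rnonneg_dec n"
    and bound: "\<And>x. lam (jabs jp e (T x)) \<prec>\<^sub>w q \<star> lam (jabs jp e x)"
  shows "lam (adjoint T e) \<prec>\<^sub>w q"
proof -
  note Q = Rnonneg_decD[OF q]
  obtain cs where cs: "jordan_frame jp e cs" "length cs = n"
    and top: "\<forall>k\<le>n. (\<Sum>i<k. adjoint T e \<bullet> cs ! i) = topsum k (lam (adjoint T e))"
    by (rule ky_fan_attained[of "adjoint T e"])
  have "topsum k (lam (adjoint T e)) \<le> topsum k q" if k: "k \<le> n" for k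
  proof -
    define x where "x = (\<Sum>i<k. cs ! i)"
    have x: "x = comb cs (\<lambda>i. of_bool (i < k))"
      using frame_prefix[OF cs(1), of k] k cs(2) by (simp add: x_def)
    have xK: "x \<in> K" unfolding x cone_comb_iff[OF cs(1)] by simp
    have lam_x: "lam x = map (\<lambda>i. of_bool (i < k)) [0..<n]"
      unfolding x by (subst lam_comb[OF cs(1)]) (auto simp: cs)
    obtain as ds where d: "spectral_decomp jp e (T x) as ds" by (rule spectral_theorem_sorted)
    note D = spectral_decompD[OF d]
    have len: "length ds = n" using jrank_eq[OF D(1)] by simp
    have "topsum k (lam (adjoint T e)) = adjoint T e \<bullet> x"
      using top k by (simp add: x_def inner_sum_right)
    also have "\<dots> = T x \<bullet> e" by (simp add: adjoint_clauses[OF lin] inner_commute)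
    also have "\<dots> = (\<Sum>i<n. T x \<bullet> ds ! i)"
      using comb_one[OF D(1)] by (simp add: len flip: inner_sum_right)
    also have "\<dots> \<le> topsum n (lam (T x))" by (rule ky_fan[OF D(1)]) simp
    also have "\<dots> \<le> topsum n (q \<star> lam x)"
      using bound[of x] jabs_cone xK pos by (simp add: weak_maj_iff lam_length)
    also have "\<dots> = (\<Sum>i<n. (q \<star> lam x) ! i)"
      using Rnonneg_decD(2)[OF cprod_Rnonneg_dec[OF q lam_cone[OF xK]]]
      by (intro topsum_dec) (simp_all add: Q(1) lam_length)
    also have "\<dots> = (\<Sum>i<k. q ! i)"
      by (rule sum.mono_neutral_cong_right) (use k Q(1) in \<open>auto simp: nth_cprod lam_x\<close>)
    also have "\<dots> = topsum k q" using k Q by (simp add: topsum_dec)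
    finally show ?thesis .
  qed
  then show ?thesis by (simp add: weak_maj_iff lam_length Q(1))
qed

lemma eta_eq_of_is_wsup:
  assumes h: "is_wsup n {lam (T e), lam (adjoint T e)} h"
  shows "eta jp e T = h"
proof -
  have H: "h \<in> Rnonneg_dec n" "lam (T e) \<prec>\<^sub>w h" "lam (adjoint T e) \<prec>\<^sub>w h"
    and least: "\<And>q. q \<in> Rnonneg n \<Longrightarrow> lam (T e) \<prec>\<^sub>w q \<Longrightarrow> lam (adjoint T e) \<prec>\<^sub>w q \<Longrightarrow> h \<prec>\<^sub>w q"
    using h by (auto simp: is_wsup_def)
  have "is_eta jp e T h"
    unfolding is_eta_def
    using H positive_multiplicative_bound multiplicative_bound_unit multiplicative_bound_adjoint
      least Rnonneg_decD(4) by blast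
  moreover have "h' = h" if "is_eta jp e T h'" for h'
    using that calculation unfolding is_eta_def by (blast intro: weak_maj_antisym)
  ultimately show ?thesis unfolding eta_def by blast
qed

end
end

theorem corollary3p4:
  fixes jp :: "'a::euclidean_space \<Rightarrow> 'a \<Rightarrow> 'a" and e :: 'a and n :: nat
    and T :: "'a \<Rightarrow> 'a" and \<Lambda> \<Lambda>' :: "real list set"
  assumes "euclidean_jordan_algebra jp e"
    and "jrank jp e = n"
    and trace_inner: "\<forall>x y. x \<bullet> y = jtrace jp e (jp x y)"
    and "linear T"
    and "positive_map jp e T"
    and "\<Lambda> = {eigvals jp e (jabs jp e (T (jp c \<epsilon>))) | c \<epsilon>.
               c \<in> idempotents jp \<and> \<epsilon> \<in> unit_roots jp e}"
    and "\<Lambda>' = {eigvals jp e (jabs jp e (adjoint T (jp c \<epsilon>))) | c \<epsilon>.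
               c \<in> idempotents jp \<and> \<epsilon> \<in> unit_roots jp e}"
  shows "wsup n \<Lambda> = eigvals jp e (T e) \<and>
         wsup n \<Lambda>' = eigvals jp e (adjoint T e) \<and>
         eta jp e T = wjoin n (eigvals jp e (T e)) (eigvals jp e (adjoint T e)) \<and>
         (adjoint T = T \<longrightarrow> eta jp e T = eigvals jp e (T e))"
proof -
  interpret euclidean_jordan_algebra jp e by (rule assms(1))
  interpret trace_form_jordan_algebra jp e by unfold_locales (simp add: trace_inner)
  have pos: "T x \<in> symmetric_cone jp e" if "x \<in> symmetric_cone jp e" for x
    using assms(5) that by (auto simp: positive_map_def)
  have pos': "adjoint T x \<in> symmetric_cone jp e" if "x \<in> symmetric_cone jp e" for x
    using adjoint_pos assms(4) pos that by blast
  have lin': "linear (adjoint T)" using assms(4) by (rule adjoint_linear)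
  let ?r = "eigvals jp e (T e)" and ?s = "eigvals jp e (adjoint T e)"
  have r: "?r \<in> Rnonneg_dec n" and s: "?s \<in> Rnonneg_dec n"
    using lam_cone pos pos' unit_cone assms(2) by blast+
  have "wsup n \<Lambda> = ?r"
    unfolding assms(6) assms(2)[symmetric] by (rule wsup_eq[OF is_wsup_image[OF assms(4) pos]])
  moreover have "wsup n \<Lambda>' = ?s"
    unfolding assms(7) assms(2)[symmetric] by (rule wsup_eq[OF is_wsup_image[OF lin' pos']])
  moreover have eta: "eta jp e T = wjoin n ?r ?s"
  proof -
    obtain h where h: "is_wsup n {?r, ?s} h" using ex_wjoin[OF r s] by blast
    then have "eta jp e T = h"
      using eta_eq_of_is_wsup[OF assms(4) pos] assms(2) by blast
    then show ?thesis using wsup_eq[OF h] by (simp add: wjoin_def)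
  qed
  moreover have "eta jp e T = ?r" if "adjoint T = T"
  proof -
    have "is_wsup n {?r} ?r" by (rule is_wsup_member[OF r]) (auto simp: weak_maj_refl)
    then show ?thesis using eta that wsup_eq by (simp add: wjoin_def)
  qed
  ultimately show ?thesis by blast
qed

end
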